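(* Let $s\ge 2$ and $n\ge 1$ be integers and let $G$ be a metric star consisting of $s$ spikes of length one. For every graph $G_w$ obtained from $G$ by adding $ns$ wormholes, $\mathrm{diam}(G_w)\ge 2/(2n+1)$. Moreover, there is a choice of $ns$ wormholes for which $\mathrm{diam}(G_w)=2/(2n+1)$, and this can be achieved by a fusion, that is, by identifying $ns+1$ points of $G$ to a single point.
   Context: A metric graph is a finite edge-weighted graph regarded as a metric space in which all points in the interior of each edge are included and each edge is locally isometric to an interval whose length is the edge weight; $\mathrm{diam}(G)=\max_{x,y\in G} d_G(x,y)$ over all points of $G$, where $d_G(x,y)$ is the minimum length of a path from $x$ to $y$. The metric star with $s$ spikes of length one consists of $s$ intervals of length $1$ glued at a common endpoint. A wormhole is a pair of points of $G$ (arbitrary points, not necessarily vertices); adding a wormhole means identifying its two points, equivalently adding an edge of length zero between them. $G_w$ is the metric graph obtained after all the identifications. Different wormholes may share points. The fusion of $k+1$ points is the same as adding the $k$ wormholes joining consecutive points in some ordering of them. *)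

theory Defs
  imports Complex_Main
begin

text \<open>A metric graph is presented as a finite family of intervals, the edge \<open>e\<close> being the interval
  from \<open>0\<close> to \<open>len e\<close>, together with pairs of points to be glued. Interior points of edges
  may be glued as well, so identifications at non-vertices need no subdivision.\<close>

record 'e metric_graph =
  edges :: "'e set"
  len :: "'e \<Rightarrow> real"
  glue :: "(('e \<times> real) \<times> ('e \<times> real)) set"

definition preglued :: "'e metric_graph \<Rightarrow> ('e \<times> real) set" where
  "preglued G = (SIGMA e : edges G. {0..len G e})"

definition ident :: "'e metric_graph \<Rightarrow> (('e \<times> real) \<times> ('e \<times> real)) set" where
  "ident G = (glue G \<union> (glue G)\<inverse>)\<^sup>* \<inter> (preglued G \<times> preglued G)"

definition points :: "'e metric_graph \<Rightarrow> ('e \<times> real) set set" where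
  "points G = preglued G // ident G"

text \<open>\<open>path_of_length G X Y l\<close>: some path from \<open>X\<close> to \<open>Y\<close>, made of finitely many segments
  each inside a single edge, has length \<open>l\<close>. A path changes edges because the point it has
  reached is an equivalence class, which may contain positions on several edges.\<close>

inductive path_of_length ::
    "'e metric_graph \<Rightarrow> ('e \<times> real) set \<Rightarrow> ('e \<times> real) set \<Rightarrow> real \<Rightarrow> bool"
  for G where
  stay: "X \<in> points G \<Longrightarrow> path_of_length G X X 0"
| move: "path_of_length G X Y l \<Longrightarrow> (e, t) \<in> Y \<Longrightarrow> (e, u) \<in> preglued G
    \<Longrightarrow> path_of_length G X (ident G `` {(e, u)}) (l + \<bar>u - t\<bar>)"

text \<open>For connected metric graphs with finitely many edges and gluings the infimum and the
  supremum below are attained, so they are the minimum and maximum.\<close>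

definition graph_dist :: "'e metric_graph \<Rightarrow> ('e \<times> real) set \<Rightarrow> ('e \<times> real) set \<Rightarrow> real" where
  "graph_dist G X Y = Inf {l. path_of_length G X Y l}"

definition diam :: "'e metric_graph \<Rightarrow> real" where
  "diam G = (SUP (X, Y) \<in> points G \<times> points G. graph_dist G X Y)"

definition metric_star :: "nat \<Rightarrow> nat metric_graph" where
  "metric_star s = \<lparr>edges = {..<s}, len = (\<lambda>_. 1),
     glue = {((i, 0), (j, 0)) | i j. i < s \<and> j < s}\<rparr>"

text \<open>A wormhole is a pair of points of \<open>G\<close>, that is, of equivalence classes; gluing every
  member of one class to every member of the other identifies the two points.\<close>

definition add_wormholes ::
    "'e metric_graph \<Rightarrow> (('e \<times> real) set \<times> ('e \<times> real) set) list \<Rightarrow> 'e metric_graph" where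
  "add_wormholes G ws = G\<lparr>glue := glue G \<union> (\<Union>(X, Y) \<in> set ws. X \<times> Y)\<rparr>"

definition fusion :: "'e metric_graph \<Rightarrow> ('e \<times> real) set set \<Rightarrow> 'e metric_graph" where
  "fusion G P = G\<lparr>glue := glue G \<union> \<Union>P \<times> \<Union>P\<rparr>"

end

(* Lower bound. Let k = n s be the number of wormholes and D the diameter. Cut off from each spike
   the hair h_i beyond its last identified point; the remaining core has no leaves and first Betti
   number at most k. For a point a of the core with eccentricity R, the core has length at most
   (k - 1) D + 2 R. To see this, choose y at distance R from a and count the points at distance
   R - r from a and those at distance r from y. For r < R the two balls are disjoint, and Euler's
   formula (every vertex outside the balls has degree at least 2) bounds the count by 2 k + 2. For
   r > R only the ball about y matters; it contains a cycle, because all edges at y lead towards a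
   along geodesics, and the bound improves to 2 k - 2. Integrate over r from 0 to D.
   Taking for a the foot of the longest hair, R <= D - h_a. Since any two hairs have total length
   at most D, adding the hairs gives s <= (k + s/2) D.

   Upper bound. Fuse the centre and the points at distance 2 j / (2 n + 1) from it, 1 <= j <= n;
   then every point is within 1 / (2 n + 1) of the fused point. *)

theory Submission
  imports Defs "HOL-Analysis.Analysis"
begin

section \<open>Leafless weighted multigraphs\<close>

text \<open>The gain for r > R makes the estimate sharp. A ball without a cycle would only give the
  count 2 k there, hence core length at most k D + R, and the final estimate would miss its target
  by the length h of the longest hair. With the cycle R enters with factor 2, and 2 R <= 2 D - 2 h
  pays for two hairs of length at most h. Every further hair is at most D / 2, since it is no longer
  than the longest one and the two together have length at most D. For k = n s the factor k + s/2
  equals s (2 n + 1) / 2, whence the constant 2 / (2 n + 1). Absence of leaves relies on every spike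
  carrying an identified point off the centre. A spike without one is a hair of length 1, so then D
  >= 1 and the bound is immediate.\<close>

locale leafless_multigraph =
  fixes E :: "'e set" and V :: "'v set" and src tgt :: "'e \<Rightarrow> 'v" and l :: "'e \<Rightarrow> real"
  assumes finite_E: "finite E" and finite_V: "finite V"
    and src_in: "e \<in> E \<Longrightarrow> src e \<in> V" and tgt_in: "e \<in> E \<Longrightarrow> tgt e \<in> V"
    and len_pos: "e \<in> E \<Longrightarrow> 0 < l e"
    and degree: "v \<in> V \<Longrightarrow> 2 \<le> card {e \<in> E. src e = v} + card {e \<in> E. tgt e = v}"
begin

text \<open>For a distance function \<open>\<alpha>\<close>, the edge \<open>e\<close> ends a
  geodesic from the base point to \<open>v\<close>.\<close>

definition tight :: "('v \<Rightarrow> real) \<Rightarrow> 'v \<Rightarrow> 'e \<Rightarrow> bool" where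
  "tight \<alpha> v e \<longleftrightarrow> e \<in> E \<and>
     (tgt e = v \<and> \<alpha> v = \<alpha> (src e) + l e \<or> src e = v \<and> \<alpha> v = \<alpha> (tgt e) + l e)"

text \<open>These conditions characterise \<open>\<alpha>\<close> as the distance from \<open>a\<close>.\<close>

definition distance_from :: "'v \<Rightarrow> ('v \<Rightarrow> real) \<Rightarrow> bool" where
  "distance_from a \<alpha> \<longleftrightarrow> a \<in> V \<and> \<alpha> a = 0 \<and> (\<forall>v \<in> V. 0 \<le> \<alpha> v) \<and>
     (\<forall>e \<in> E. \<bar>\<alpha> (src e) - \<alpha> (tgt e)\<bar> \<le> l e) \<and> (\<forall>v \<in> V. v \<noteq> a \<longrightarrow> (\<exists>e. tight \<alpha> v e))"

text \<open>The maximum of the distance on the edge \<open>e\<close>.\<close>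

definition apex :: "('v \<Rightarrow> real) \<Rightarrow> 'e \<Rightarrow> real" where
  "apex \<alpha> e = (\<alpha> (src e) + \<alpha> (tgt e) + l e) / 2"

text \<open>For all but finitely many \<open>r\<close>, the number of points of the edge \<open>e\<close> at distance \<open>r\<close>.\<close>

definition sphere_count :: "('v \<Rightarrow> real) \<Rightarrow> real \<Rightarrow> 'e \<Rightarrow> real" where
  "sphere_count \<alpha> r e =
     indicator {min (\<alpha> (src e)) (\<alpha> (tgt e)) .. max (\<alpha> (src e)) (\<alpha> (tgt e))} r
     + 2 * indicator {max (\<alpha> (src e)) (\<alpha> (tgt e)) .. apex \<alpha> e} r"

text \<open>Radii at which a sphere passes through a vertex or the top of an edge, where the closed
  intervals in \<open>sphere_count\<close> may overlap. They are finitely many and do not affect the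
  integrals.\<close>

definition critical :: "('v \<Rightarrow> real) \<Rightarrow> real set" where
  "critical \<alpha> = \<alpha> ` V \<union> apex \<alpha> ` E"

definition ball_at :: "('v \<Rightarrow> real) \<Rightarrow> real \<Rightarrow> 'v set" where
  "ball_at \<alpha> r = {v \<in> V. \<alpha> v < r}"

lemma finite_critical: "finite (critical \<alpha>)"
  by (simp add: critical_def finite_E finite_V)

lemma apex_ge:
  assumes "distance_from a \<alpha>" "e \<in> E"
  shows "max (\<alpha> (src e)) (\<alpha> (tgt e)) \<le> apex \<alpha> e"
  using assms unfolding distance_from_def apex_def by (auto simp: max_def abs_le_iff field_simps)

text \<open>The distance rises with slope 1 from both ends of \<open>e\<close> to
  \<open>apex\<close>, so a sphere meets the edge once when it separates the ends and twice when
  only the top lies outside.\<close>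

lemma sphere_count_eq:
  assumes "distance_from a \<alpha>" "e \<in> E" "r \<notin> critical \<alpha>"
  shows "sphere_count \<alpha> r e =
    (if (src e \<in> ball_at \<alpha> r) \<noteq> (tgt e \<in> ball_at \<alpha> r) then 1
     else if src e \<in> ball_at \<alpha> r \<and> r < apex \<alpha> e then 2 else 0)"
proof -
  have ne: "r \<noteq> \<alpha> (src e)" "r \<noteq> \<alpha> (tgt e)" "r \<noteq> apex \<alpha> e"
    using assms src_in tgt_in by (auto simp: critical_def)
  have "max (\<alpha> (src e)) (\<alpha> (tgt e)) \<le> apex \<alpha> e"
    by (rule apex_ge[OF assms(1,2)])
  then show ?thesis
    using ne assms(2) src_in tgt_in
    by (auto simp: sphere_count_def ball_at_def indicator_def min_def max_def split: if_splits)
qed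

text \<open>Handshake count restricted to \<open>U\<close>; a loop contributes both of its ends, as
  in \<open>degree\<close>.\<close>

lemma sum_ends_ge:
  assumes "U \<subseteq> V"
  shows "2 * real (card U) \<le> (\<Sum>e\<in>E. of_bool (src e \<in> U) + of_bool (tgt e \<in> U))"
proof -
  have fU: "finite U" using assms finite_V finite_subset by blast
  have *: "(\<Sum>e\<in>E. of_bool (f e \<in> U)) = (\<Sum>v\<in>U. real (card {e \<in> E. f e = v}))" for f :: "'e \<Rightarrow> 'v"
  proof -
    have "(\<Sum>v\<in>U. real (card {e \<in> E. f e = v})) = (\<Sum>v\<in>U. \<Sum>e\<in>E. of_bool (f e = v))"
      using finite_E by (simp add: Int_def)
    also have "\<dots> = (\<Sum>e\<in>E. \<Sum>v\<in>U. of_bool (f e = v))" by (rule sum.swap)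
    also have "\<dots> = (\<Sum>e\<in>E. of_bool (f e \<in> U))"
      by (intro sum.cong refl) (auto simp: fU of_bool_def)
    finally show ?thesis by simp
  qed
  have "2 * real (card U) = (\<Sum>v\<in>U. 2)" by simp
  also have "\<dots> \<le> (\<Sum>v\<in>U. real (card {e \<in> E. src e = v}) + real (card {e \<in> E. tgt e = v}))"
    using degree assms by (intro sum_mono) (metis in_mono of_nat_add of_nat_le_iff of_nat_numeral)
  also have "\<dots> = (\<Sum>e\<in>E. of_bool (src e \<in> U) + of_bool (tgt e \<in> U))"
    by (simp add: sum.distrib *)
  finally show ?thesis .
qed

text \<open>Every edge has a budget of 2, which pays for its sphere points and its ends in
  \<open>U\<close>, or is used up entirely by membership in \<open>T\<close>. Summing gives Euler's
  formula as an inequality.\<close>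

lemma discharge:
  assumes "U \<subseteq> V" "T \<subseteq> E"
    and "\<And>e. e \<in> E \<Longrightarrow>
      c e + of_bool (src e \<in> U) + of_bool (tgt e \<in> U) + 2 * of_bool (e \<in> T) \<le> (2::real)"
  shows "sum c E \<le> 2 * real (card E) - 2 * real (card U) - 2 * real (card T)"
proof -
  have "(\<Sum>e\<in>E. c e + (of_bool (src e \<in> U) + of_bool (tgt e \<in> U)) + 2 * of_bool (e \<in> T))
      \<le> (\<Sum>e\<in>E. 2)"
    using assms(3) by (intro sum_mono) (simp add: add.assoc)
  moreover have "(\<Sum>e\<in>E. 2 * of_bool (e \<in> T)) = 2 * real (card T)"
    using assms(2) finite_E by (simp add: sum_distrib_left[symmetric] Int_absorb1)
  ultimately show ?thesis
    using sum_ends_ge[OF assms(1)] by (simp add: sum.distrib)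
qed

section \<open>Vertices and edges inside balls\<close>

definition upper :: "('v \<Rightarrow> real) \<Rightarrow> 'e \<Rightarrow> 'v" where
  "upper \<alpha> e = (if \<alpha> (src e) < \<alpha> (tgt e) then tgt e else src e)"

definition lower :: "('v \<Rightarrow> real) \<Rightarrow> 'e \<Rightarrow> 'v" where
  "lower \<alpha> e = (if \<alpha> (src e) < \<alpha> (tgt e) then src e else tgt e)"

lemma tight_upper: "tight \<alpha> v e \<Longrightarrow> upper \<alpha> e = v"
  using len_pos by (force simp: tight_def upper_def)

lemma tight_apex: "tight \<alpha> v e \<Longrightarrow> apex \<alpha> e = \<alpha> v"
  by (auto simp: tight_def apex_def)

lemma tight_ball:
  assumes "tight \<alpha> v e" "v \<in> ball_at \<alpha> r"
  shows "e \<in> E \<and> src e \<in> ball_at \<alpha> r \<and> tgt e \<in> ball_at \<alpha> r \<and> apex \<alpha> e < r"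
  using assms src_in[of e] tgt_in[of e] len_pos[of e] tight_apex[OF assms(1)]
  by (auto simp: tight_def ball_at_def)

text \<open>An edge with both ends in the ball can leave it in the middle; the bound on
  \<open>apex\<close> keeps the edges that lie in the ball entirely.\<close>

definition ball_edges :: "('v \<Rightarrow> real) \<Rightarrow> real \<Rightarrow> 'e set" where
  "ball_edges \<alpha> r = {e \<in> E. src e \<in> ball_at \<alpha> r \<and> tgt e \<in> ball_at \<alpha> r \<and> apex \<alpha> e < r}"

lemma finite_ball_edges: "finite (ball_edges \<alpha> r)"
  by (simp add: ball_edges_def finite_E)

lemma finite_ball_at: "finite (ball_at \<alpha> r)"
  by (simp add: ball_at_def finite_V)

text \<open>Charge every vertex other than \<open>a\<close> to an edge ending a geodesic from
  \<open>a\<close>. Such an edge stays inside the ball, and its upper end recovers the vertex, so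
  the charges are distinct.\<close>

lemma card_ball_le:
  assumes "distance_from a \<alpha>"
  shows "card (ball_at \<alpha> r) \<le> card (ball_edges \<alpha> r) + 1"
proof -
  have "\<forall>v \<in> ball_at \<alpha> r - {a}. \<exists>e. tight \<alpha> v e"
    using assms by (auto simp: distance_from_def ball_at_def)
  then obtain p where p: "\<And>v. v \<in> ball_at \<alpha> r - {a} \<Longrightarrow> tight \<alpha> v (p v)"
    by (metis bchoice)
  have "inj_on p (ball_at \<alpha> r - {a})"
    using p tight_upper by (metis inj_onI)
  moreover have "p ` (ball_at \<alpha> r - {a}) \<subseteq> ball_edges \<alpha> r"
    using p tight_ball by (fastforce simp: ball_edges_def)
  ultimately have "card (ball_at \<alpha> r - {a}) \<le> card (ball_edges \<alpha> r)"
    using finite_ball_edges card_inj_on_le by blast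
  then show ?thesis
    using card_Diff1_le[of "ball_at \<alpha> r" a] finite_ball_at[of \<alpha> r]
    by (cases "a \<in> ball_at \<alpha> r") (auto simp: card_Diff_singleton)
qed

text \<open>A point \<open>y\<close> farthest from \<open>a\<close> is reached by at least two geodesics from \<open>a\<close>, since all its
  edges point towards \<open>a\<close>. So a ball about \<open>y\<close> that contains \<open>a\<close> contains a cycle. The count
  below makes this precise: vertices on geodesics between \<open>a\<close> and \<open>y\<close> are charged to an edge
  towards \<open>a\<close>, all others to an edge towards \<open>y\<close>, and an edge at \<open>y\<close> remains.\<close>

lemma card_ball_le_cyclic:
  assumes \<alpha>: "distance_from a \<alpha>" and \<beta>: "distance_from y \<beta>"
    and R: "\<alpha> y = R" "\<beta> a = R" "\<And>v. v \<in> V \<Longrightarrow> R \<le> \<alpha> v + \<beta> v"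
    and far: "\<And>e. e \<in> E \<Longrightarrow> apex \<alpha> e \<le> R" and "R < r"
  shows "card (ball_at \<beta> r) \<le> card (ball_edges \<beta> r)"
proof -
  have y: "y \<in> V" "\<beta> y = 0" and a: "a \<in> V" "\<alpha> a = 0"
    using \<alpha> \<beta> by (auto simp: distance_from_def)
  have lip: "\<bar>\<alpha> (src e) - \<alpha> (tgt e)\<bar> \<le> l e" "\<bar>\<beta> (src e) - \<beta> (tgt e)\<bar> \<le> l e" if "e \<in> E" for e
    using that \<alpha> \<beta> by (auto simp: distance_from_def)
  define W where "W = {v \<in> V. \<alpha> v + \<beta> v = R}"
  let ?B = "ball_at \<beta> r"
  have WB: "W \<subseteq> ?B"
    using \<alpha> \<open>R < r\<close> by (force simp: W_def ball_at_def distance_from_def)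
  \<comment> \<open>Towards the other end of the edge \<open>\<alpha>\<close> drops by
    \<open>l e\<close> and \<open>\<beta>\<close> grows by at most \<open>l e\<close>. Since their
    sum stays at least \<open>R\<close>, \<open>\<beta>\<close> grows by exactly \<open>l e\<close>,
    and the other end is again in \<open>W\<close>.\<close>
  have edge: "lower \<beta> e = v \<and> upper \<beta> e \<in> W \<and> e \<in> ball_edges \<beta> r"
    if "v \<in> W" "tight \<alpha> v e" for v e
  proof -
    have e: "e \<in> E" using that(2) by (simp add: tight_def)
    note f = lip[OF e] len_pos[OF e] src_in[OF e] tgt_in[OF e] R(3)[OF src_in[OF e]] R(3)[OF tgt_in[OF e]]
    have *: "tgt e = v \<and> src e \<in> W \<and> \<beta> (src e) = \<beta> v + l e
        \<or> src e = v \<and> tgt e \<in> W \<and> \<beta> (tgt e) = \<beta> v + l e"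
      using that f by (auto simp: tight_def W_def)
    then have "\<beta> (src e) + \<beta> (tgt e) + l e < 2 * r"
      using WB by (force simp: ball_at_def)
    then have "e \<in> ball_edges \<beta> r"
      using * WB that(1) e by (auto simp: ball_edges_def apex_def)
    then show ?thesis
      using * f that(1) by (auto simp: lower_def upper_def)
  qed
  \<comment> \<open>An edge at \<open>y\<close> that is not tight would have its \<open>apex\<close>
    above \<open>R\<close>, the value of \<open>\<alpha>\<close> at \<open>y\<close>.\<close>
  have tight_y: "tight \<alpha> y e" if "e \<in> E" "src e = y \<or> tgt e = y" for e
    using that far[OF that(1)] lip(1)[OF that(1)] R(1) by (auto simp: tight_def apex_def)
  have yW: "y \<in> W" using y R by (simp add: W_def)
  let ?S = "{e \<in> E. src e = y}" and ?T = "{e \<in> E. tgt e = y}"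
  have disj: "?S \<inter> ?T = {}"
    using tight_y len_pos by (force simp: tight_def)
  have two: "2 \<le> card (?S \<union> ?T)"
    using degree[OF y(1)] disj finite_E by (subst card_Un_disjoint) auto
  have "y \<noteq> a"
  proof
    assume "y = a"
    then have "R = 0" using R a by simp
    have "?S \<union> ?T \<noteq> {}" using two by (metis card.empty not_numeral_le_zero)
    then obtain e where "e \<in> ?S \<union> ?T" by blast
    then have e: "e \<in> E" and "tight \<alpha> y e" using tight_y by blast+
    then have "\<alpha> y = \<alpha> (src e) + l e \<or> \<alpha> y = \<alpha> (tgt e) + l e" by (auto simp: tight_def)
    moreover have "0 \<le> \<alpha> (src e)" "0 \<le> \<alpha> (tgt e)"
      using \<alpha> src_in[OF e] tgt_in[OF e] by (auto simp: distance_from_def)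
    ultimately show False using len_pos[OF e] R(1) \<open>R = 0\<close> by linarith
  qed
  have "\<forall>v \<in> V - {a}. \<exists>e. tight \<alpha> v e" "\<forall>v \<in> V - {y}. \<exists>e. tight \<beta> v e"
    using \<alpha> \<beta> by (auto simp: distance_from_def)
  then obtain p q where p: "\<And>v. v \<in> V - {a} \<Longrightarrow> tight \<alpha> v (p v)"
    and q: "\<And>v. v \<in> V - {y} \<Longrightarrow> tight \<beta> v (q v)"
    by (metis bchoice)
  have "\<not> ?S \<union> ?T \<subseteq> {p y}"
    using two card_mono[of "{p y}" "?S \<union> ?T"] by auto
  then obtain e' where e': "e' \<in> E" "src e' = y \<or> tgt e' = y" "e' \<noteq> p y" by blast
  define f where "f v = (if v \<in> W then p v else q v)" for v
  have fW: "lower \<beta> (f v) = v \<and> upper \<beta> (f v) \<in> W \<and> f v \<in> ball_edges \<beta> r"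
    if "v \<in> ?B - {a}" "v \<in> W" for v
    using that edge[OF that(2) p] by (auto simp: f_def W_def)
  have fN: "upper \<beta> (f v) = v \<and> f v \<in> ball_edges \<beta> r" if "v \<in> ?B - {a}" "v \<notin> W" for v
  proof -
    have "v \<in> V - {y}" using that yW by (auto simp: ball_at_def)
    then show ?thesis
      using q[of v] tight_upper tight_ball[of \<beta> v "q v" r] that by (auto simp: f_def ball_edges_def)
  qed
  \<comment> \<open>Charges of vertices in \<open>W\<close> have their upper end in \<open>W\<close>
    and are recovered from the lower end. The other charges have their upper end outside
    \<open>W\<close> and are recovered from it, so the two kinds never coincide.\<close>
  have "inj_on f (?B - {a})"
    by (rule inj_onI) (metis fW fN)
  moreover have "f ` (?B - {a}) \<subseteq> ball_edges \<beta> r - {e'}"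
  proof
    fix e assume "e \<in> f ` (?B - {a})"
    then obtain v where v: "v \<in> ?B - {a}" "e = f v" by blast
    have "e \<noteq> e'"
    proof
      assume "e = e'"
      note ee = edge[OF yW tight_y[OF e'(1,2)]]
      show False
      proof (cases "v \<in> W")
        case True
        then have "v = y" using fW[OF v(1)] ee v \<open>e = e'\<close> by simp
        then show False using e'(3) v True \<open>e = e'\<close> by (simp add: f_def)
      next
        case False
        then show False using fN[OF v(1)] ee v \<open>e = e'\<close> by simp
      qed
    qed
    moreover have "e \<in> ball_edges \<beta> r" using v fW fN by blast
    ultimately show "e \<in> ball_edges \<beta> r - {e'}" by blast
  qed
  ultimately have "card (?B - {a}) \<le> card (ball_edges \<beta> r - {e'})"
    using finite_ball_edges by (meson card_inj_on_le finite_Diff)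
  moreover have "e' \<in> ball_edges \<beta> r" using edge[OF yW tight_y[OF e'(1,2)]] by blast
  \<comment> \<open>One vertex, \<open>a\<close>, and one edge, \<open>e'\<close>, were set aside;
    both lie in the ball, so the two counts are reduced equally.\<close>
  moreover have "a \<in> ?B" using a R \<open>R < r\<close> by (simp add: ball_at_def)
  ultimately show ?thesis
    using finite_ball_edges[of \<beta> r] finite_ball_at[of \<beta> r]
    by (simp add: card_Diff_singleton) (metis Suc_pred card_gt_0_iff empty_iff Suc_le_mono)
qed

text \<open>The triangle inequality keeps the balls disjoint, so no edge exceeds its budget. Each
  ball has at most one vertex more than it has edges; these two units, doubled, are the 4.\<close>

lemma sphere_count_two_balls:
  assumes \<alpha>: "distance_from a \<alpha>" and \<beta>: "distance_from y \<beta>"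
    and R: "\<And>v. v \<in> V \<Longrightarrow> R \<le> \<alpha> v + \<beta> v"
    and r: "R - r \<notin> critical \<alpha>" "r \<notin> critical \<beta>"
  shows "(\<Sum>e\<in>E. sphere_count \<alpha> (R - r) e + sphere_count \<beta> r e)
    \<le> 2 * real (card E) - 2 * real (card V) + 4"
proof -
  let ?A = "ball_at \<alpha> (R - r)" and ?B = "ball_at \<beta> r"
  let ?U = "V - (?A \<union> ?B)" and ?T = "ball_edges \<alpha> (R - r) \<union> ball_edges \<beta> r"
  have AB: "?A \<inter> ?B = {}" using R by (force simp: ball_at_def)
  have TT: "ball_edges \<alpha> (R - r) \<inter> ball_edges \<beta> r = {}"
    using AB by (auto simp: ball_edges_def)
  have "(\<Sum>e\<in>E. sphere_count \<alpha> (R - r) e + sphere_count \<beta> r e)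
      \<le> 2 * real (card E) - 2 * real (card ?U) - 2 * real (card ?T)"
  proof (rule discharge)
    fix e assume e: "e \<in> E"
    show "sphere_count \<alpha> (R - r) e + sphere_count \<beta> r e + of_bool (src e \<in> ?U)
        + of_bool (tgt e \<in> ?U) + 2 * of_bool (e \<in> ?T) \<le> 2"
      using AB src_in[OF e] tgt_in[OF e] e
      by (auto simp: sphere_count_eq[OF \<alpha> e r(1)] sphere_count_eq[OF \<beta> e r(2)] ball_edges_def)
  qed (auto simp: ball_edges_def)
  moreover have "card ?T = card (ball_edges \<alpha> (R - r)) + card (ball_edges \<beta> r)"
    using TT by (simp add: card_Un_disjoint finite_ball_edges)
  moreover have "card (?A \<union> ?B) = card ?A + card ?B"
    using AB by (simp add: card_Un_disjoint finite_ball_at)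
  moreover have "card V = card ?U + card (?A \<union> ?B)"
  proof -
    have "?A \<union> ?B \<subseteq> V" by (auto simp: ball_at_def)
    then show ?thesis
      by (metis card_Diff_subset card_mono finite_V finite_subset le_add_diff_inverse2)
  qed
  ultimately show ?thesis
    using card_ball_le[OF \<alpha>, of "R - r"] card_ball_le[OF \<beta>, of r] by linarith
qed

lemma sphere_count_one_ball:
  assumes \<beta>: "distance_from y \<beta>" and r: "r \<notin> critical \<beta>"
    and cyc: "card (ball_at \<beta> r) \<le> card (ball_edges \<beta> r)"
  shows "(\<Sum>e\<in>E. sphere_count \<beta> r e) \<le> 2 * real (card E) - 2 * real (card V)"
proof -
  let ?B = "ball_at \<beta> r"
  have "(\<Sum>e\<in>E. sphere_count \<beta> r e)
      \<le> 2 * real (card E) - 2 * real (card (V - ?B)) - 2 * real (card (ball_edges \<beta> r))"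
  proof (rule discharge)
    fix e assume e: "e \<in> E"
    show "sphere_count \<beta> r e + of_bool (src e \<in> V - ?B)
        + of_bool (tgt e \<in> V - ?B) + 2 * of_bool (e \<in> ball_edges \<beta> r) \<le> 2"
      using src_in[OF e] tgt_in[OF e] e
      by (auto simp: sphere_count_eq[OF \<beta> e r] ball_edges_def)
  qed (auto simp: ball_edges_def)
  moreover have "card V = card (V - ?B) + card ?B"
    by (metis (no_types, lifting) card_Diff_subset card_mono finite_V finite_ball_at
        ball_at_def le_add_diff_inverse2 mem_Collect_eq subsetI)
  ultimately show ?thesis using cyc by linarith
qed

end

section \<open>Integration over the radii\<close>

lemma has_integral_indicator_interval:
  fixes p q x z :: real
  assumes "x \<le> p" "p \<le> q" "q \<le> z"
  shows "(indicator {p..q} has_integral (q - p)) {x..z}"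
proof -
  have "((\<lambda>_. 1::real) has_integral (q - p)) {p..q}"
    using has_integral_const_real[of "1::real" p q] assms by simp
  then have "((\<lambda>t. if t \<in> {p..q} then 1 else 0::real) has_integral (q - p)) {x..z}"
    using assms by (subst has_integral_restrict) auto
  then show ?thesis by (simp add: indicator_def[abs_def] of_bool_def)
qed

context leafless_multigraph
begin

text \<open>One-dimensional coarea formula: distances between those of the two ends are taken once
  on the edge, those from there up to \<open>apex\<close> twice.\<close>

lemma sphere_count_has_integral:
  assumes \<alpha>: "distance_from a \<alpha>" and e: "e \<in> E" and "apex \<alpha> e \<le> D"
  shows "((\<lambda>r. sphere_count \<alpha> r e) has_integral l e) {0..D}"
proof -
  let ?m = "min (\<alpha> (src e)) (\<alpha> (tgt e))" and ?M = "max (\<alpha> (src e)) (\<alpha> (tgt e))"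
  have "0 \<le> ?m" using \<alpha> src_in[OF e] tgt_in[OF e] by (auto simp: distance_from_def)
  have "?m \<le> ?M" "?M \<le> apex \<alpha> e" using apex_ge[OF \<alpha> e] by auto
  have 1: "(indicator {?m..?M} has_integral (?M - ?m)) {0..D}"
    and 2: "(indicator {?M..apex \<alpha> e} has_integral (apex \<alpha> e - ?M)) {0..D}"
    using \<open>0 \<le> ?m\<close> \<open>?m \<le> ?M\<close> \<open>?M \<le> apex \<alpha> e\<close> assms(3)
    by (intro has_integral_indicator_interval; linarith)+
  have "((\<lambda>r. sphere_count \<alpha> r e) has_integral (?M - ?m + 2 * (apex \<alpha> e - ?M))) {0..D}"
    unfolding sphere_count_def by (intro has_integral_add has_integral_mult_right 1 2)
  moreover have "?M - ?m + 2 * (apex \<alpha> e - ?M) = l e" by (auto simp: apex_def min_def max_def field_simps)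
  ultimately show ?thesis by simp
qed

text \<open>The bounds on \<open>apex\<close> and \<open>R\<close> ensure that the reflection
  \<open>R - r\<close> keeps the whole range of distances within \<open>{0..D}\<close>.\<close>

lemma reflected_sphere_count_has_integral:
  assumes \<alpha>: "distance_from a \<alpha>" and e: "e \<in> E" and "apex \<alpha> e \<le> R" "R \<le> D"
  shows "((\<lambda>r. sphere_count \<alpha> (R - r) e) has_integral l e) {0..D}"
proof -
  let ?m = "min (\<alpha> (src e)) (\<alpha> (tgt e))" and ?M = "max (\<alpha> (src e)) (\<alpha> (tgt e))"
  have "0 \<le> ?m" using \<alpha> src_in[OF e] tgt_in[OF e] by (auto simp: distance_from_def)
  have "?m \<le> ?M" "?M \<le> apex \<alpha> e" using apex_ge[OF \<alpha> e] by auto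
  have refl: "indicator {p..q} (R - r) = (indicator {R - q..R - p} r :: real)" for p q r
    by (auto simp: indicator_def)
  have 1: "(indicator {R - ?M..R - ?m} has_integral ((R - ?m) - (R - ?M))) {0..D}"
    and 2: "(indicator {R - apex \<alpha> e..R - ?M} has_integral ((R - ?M) - (R - apex \<alpha> e))) {0..D}"
    using \<open>0 \<le> ?m\<close> \<open>?m \<le> ?M\<close> \<open>?M \<le> apex \<alpha> e\<close> assms(3,4)
    by (intro has_integral_indicator_interval; linarith)+
  have "((\<lambda>r. sphere_count \<alpha> (R - r) e) has_integral
      ((R - ?m) - (R - ?M) + 2 * ((R - ?M) - (R - apex \<alpha> e)))) {0..D}"
    unfolding sphere_count_def refl by (intro has_integral_add has_integral_mult_right 1 2)
  moreover have "(R - ?m) - (R - ?M) + 2 * ((R - ?M) - (R - apex \<alpha> e)) = l e"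
    by (auto simp: apex_def min_def max_def field_simps)
  ultimately show ?thesis by simp
qed

text \<open>Every edge is swept once from \<open>a\<close> and once from \<open>y\<close>, so the
  integral of the counts is twice the total length.\<close>

theorem total_length_le:
  assumes \<alpha>: "distance_from a \<alpha>" and \<beta>: "distance_from y \<beta>"
    and R: "\<alpha> y = R" "\<beta> a = R" "\<And>v. v \<in> V \<Longrightarrow> R \<le> \<alpha> v + \<beta> v"
    and far: "\<And>e. e \<in> E \<Longrightarrow> apex \<alpha> e \<le> R" and D: "\<And>e. e \<in> E \<Longrightarrow> apex \<beta> e \<le> D" "R \<le> D"
    and k: "real (card E) \<le> real (card V) - 1 + k"
  shows "sum l E \<le> (k - 1) * D + 2 * R"
proof -
  have "0 \<le> R" using R \<alpha> \<beta> by (auto simp: distance_from_def)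
  let ?N = "\<lambda>r. \<Sum>e\<in>E. sphere_count \<alpha> (R - r) e + sphere_count \<beta> r e"
  let ?b = "\<lambda>r. (2 * k - 2) * indicator {0..D} r + 4 * indicator {0..R} r"
  define X where "X = (\<lambda>t. R - t) ` critical \<alpha> \<union> critical \<beta> \<union> {R}"
  have "finite X" by (simp add: X_def finite_critical)
  have intN: "(?N has_integral (\<Sum>e\<in>E. l e + l e)) {0..D}"
    by (intro has_integral_sum finite_E has_integral_add
        reflected_sphere_count_has_integral[OF \<alpha>] sphere_count_has_integral[OF \<beta>] far D)
  have intb: "(?b has_integral ((2 * k - 2) * (D - 0) + 4 * (R - 0))) {0..D}"
    using \<open>0 \<le> R\<close> D(2)
    by (intro has_integral_add has_integral_mult_right has_integral_indicator_interval) auto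
  have le: "?N r \<le> ?b r" if r: "r \<in> {0..D} - X" for r
  proof -
    have gen: "R - r \<notin> critical \<alpha>" "r \<notin> critical \<beta>" "r \<noteq> R"
      using r by (auto simp: X_def image_iff)
    show ?thesis
    proof (cases "r < R")
      case True
      then show ?thesis
        using sphere_count_two_balls[OF \<alpha> \<beta> R(3) gen(1,2)] k r by simp
    next
      case False
      then have "R < r" using gen by simp
      have "sphere_count \<alpha> (R - r) e = 0" if e: "e \<in> E" for e
      proof -
        have "0 \<le> \<alpha> (src e)" "0 \<le> \<alpha> (tgt e)"
          using \<alpha> src_in[OF e] tgt_in[OF e] by (auto simp: distance_from_def)
        then have "R - r < min (\<alpha> (src e)) (\<alpha> (tgt e))" "R - r < max (\<alpha> (src e)) (\<alpha> (tgt e))"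
          using \<open>R < r\<close> by auto
        then show ?thesis by (auto simp: sphere_count_def indicator_def min_def max_def split: if_splits)
      qed
      then show ?thesis
        using sphere_count_one_ball[OF \<beta> gen(2) card_ball_le_cyclic[OF \<alpha> \<beta> R far \<open>R < r\<close>]]
          k r \<open>R < r\<close> by simp
    qed
  qed
  \<comment> \<open>On the finite set \<open>X\<close> the count is replaced by its bound, so that
    the comparison holds at every radius.\<close>
  have "((\<lambda>r. if r \<in> X then ?b r else ?N r) has_integral (\<Sum>e\<in>E. l e + l e)) {0..D}"
    by (rule has_integral_spike_finite[OF \<open>finite X\<close> _ intN]) simp
  from has_integral_le[OF this intb] le
  have "(\<Sum>e\<in>E. l e + l e) \<le> (2 * k - 2) * (D - 0) + 4 * (R - 0)" by auto
  moreover have "(\<Sum>e\<in>E. l e + l e) = 2 * sum l E" by (simp only: sum.distrib mult_2)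
  ultimately show ?thesis by (simp add: algebra_simps)
qed

end

section \<open>Distances in a star with identifications\<close>

lemma ident_refl: "p \<in> preglued G \<Longrightarrow> (p, p) \<in> ident G"
  by (simp add: ident_def)

lemma ident_sym: "(p, q) \<in> ident G \<Longrightarrow> (q, p) \<in> ident G"
proof -
  have "sym ((glue G \<union> (glue G)\<inverse>)\<^sup>*)" by (intro sym_rtrancl sym_Un_converse)
  then show "(p, q) \<in> ident G \<Longrightarrow> (q, p) \<in> ident G" by (auto simp: ident_def dest: symD)
qed

lemma ident_trans: "(p, q) \<in> ident G \<Longrightarrow> (q, r) \<in> ident G \<Longrightarrow> (p, r) \<in> ident G"
  by (auto simp: ident_def)

lemma ident_subset: "(p, q) \<in> ident G \<Longrightarrow> p \<in> preglued G \<and> q \<in> preglued G"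
  by (simp add: ident_def)

lemma class_in_points: "p \<in> preglued G \<Longrightarrow> ident G `` {p} \<in> points G"
  by (auto simp: points_def intro: quotientI)

lemma pointsE:
  assumes "X \<in> points G"
  obtains p where "p \<in> preglued G" "X = ident G `` {p}"
  using assms by (auto simp: points_def elim: quotientE)

lemma ident_invariant:
  assumes "\<And>p q. (p, q) \<in> glue G \<Longrightarrow> f p = f q" "(p, q) \<in> ident G"
  shows "f p = f q"
proof -
  have "(p, q) \<in> (glue G \<union> (glue G)\<inverse>)\<^sup>*" using assms(2) by (simp add: ident_def)
  then show ?thesis
    by (induction rule: rtrancl_induct) (auto simp: assms(1))
qed

lemma path_points: "path_of_length G X Y l \<Longrightarrow> X \<in> points G \<and> Y \<in> points G \<and> 0 \<le> l"
  by (induction rule: path_of_length.induct) (auto intro: class_in_points)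

lemma path_through:
  assumes "(i, t) \<in> preglued G" "(j, u) \<in> preglued G" "((i, v), (j, w)) \<in> ident G"
  shows "path_of_length G (ident G `` {(i, t)}) (ident G `` {(j, u)}) (\<bar>v - t\<bar> + \<bar>u - w\<bar>)"
proof -
  have m: "(i, v) \<in> preglued G" using assms(3) ident_subset by blast
  have "path_of_length G (ident G `` {(i, t)}) (ident G `` {(i, v)}) (0 + \<bar>v - t\<bar>)"
    by (rule path_of_length.move[OF path_of_length.stay])
      (auto simp: assms m class_in_points ident_refl)
  from path_of_length.move[OF this, of j w u] show ?thesis
    using assms by simp
qed

lemma graph_dist_le: "path_of_length G X Y l \<Longrightarrow> graph_dist G X Y \<le> l"
  unfolding graph_dist_def using path_points by (intro cInf_lower bdd_belowI[of _ 0]) auto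

lemma diam_le:
  assumes "preglued G \<noteq> {}"
    and "\<And>p q. p \<in> preglued G \<Longrightarrow> q \<in> preglued G \<Longrightarrow>
      \<exists>l \<le> c. path_of_length G (ident G `` {p}) (ident G `` {q}) l"
  shows "diam G \<le> c"
  unfolding diam_def
proof (rule cSUP_least)
  show "points G \<times> points G \<noteq> {}"
    using assms(1) class_in_points by fastforce
  fix XY assume "XY \<in> points G \<times> points G"
  then obtain X Y where XY: "XY = (X, Y)" "X \<in> points G" "Y \<in> points G" by auto
  from XY(2) obtain p where "p \<in> preglued G" "X = ident G `` {p}" by (rule pointsE)
  moreover from XY(3) obtain q where "q \<in> preglued G" "Y = ident G `` {q}" by (rule pointsE)
  ultimately obtain l where "l \<le> c" "path_of_length G X Y l" using assms(2) by blast
  then have "graph_dist G X Y \<le> c" using graph_dist_le by force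
  then show "(case XY of (X, Y) \<Rightarrow> graph_dist G X Y) \<le> c" by (simp add: XY(1))
qed

text \<open>\<open>merge\<close> says that the gluing lowers the number of points of a finite set by at most
  \<open>s - 1\<close> (for the centre) plus \<open>k\<close> (for the wormholes).\<close>

locale glued_star =
  fixes s k :: nat and G :: "nat metric_graph"
  assumes two: "2 \<le> s" and preglued: "preglued G = {..<s} \<times> {0..1}"
    and glue_subset: "glue G \<subseteq> preglued G \<times> preglued G" and finite_glue: "finite (glue G)"
    and centre: "i < s \<Longrightarrow> j < s \<Longrightarrow> ((i, 0), (j, 0)) \<in> glue G"
    and merge: "F \<subseteq> preglued G \<Longrightarrow> finite F \<Longrightarrow> (\<And>i. i < s \<Longrightarrow> (i, 0) \<in> F) \<Longrightarrow>
      \<exists>g :: nat \<times> real \<Rightarrow> nat \<times> real.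
        (\<forall>(p, q) \<in> glue G. g p = g q) \<and> card F + 1 \<le> card (g ` F) + s + k"
begin

section \<open>Potentials and the dual distance\<close>

abbreviation H :: "(nat \<times> real) set" where "H \<equiv> preglued G"

text \<open>Potentials on the glued star, 1-Lipschitz along each spike: the test functions that
  bound distances from below.\<close>

definition lip :: "(nat \<times> real \<Rightarrow> real) \<Rightarrow> bool" where
  "lip \<psi> \<longleftrightarrow> (\<forall>i t u. (i, t) \<in> H \<longrightarrow> (i, u) \<in> H \<longrightarrow> \<psi> (i, t) \<le> \<psi> (i, u) + \<bar>t - u\<bar>)
     \<and> (\<forall>(p, q) \<in> glue G. \<psi> p = \<psi> q)"

text \<open>The dual form of the distance. Used instead of \<open>graph_dist\<close>, it makes the existence of
  geodesics (see \<open>exists_tight_mark\<close>) independent of the attainment of the infimum over paths.\<close>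

definition d :: "nat \<times> real \<Rightarrow> nat \<times> real \<Rightarrow> real" where
  "d p q = (SUP \<psi> \<in> Collect lip. \<psi> q - \<psi> p)"

lemma lip_D: "lip \<psi> \<Longrightarrow> (i, t) \<in> H \<Longrightarrow> (i, u) \<in> H \<Longrightarrow> \<psi> (i, t) \<le> \<psi> (i, u) + \<bar>t - u\<bar>"
  by (simp add: lip_def)

lemma lip_ident: "lip \<psi> \<Longrightarrow> (p, q) \<in> ident G \<Longrightarrow> \<psi> p = \<psi> q"
  by (rule ident_invariant[of G]) (auto simp: lip_def)

text \<open>Both points are compared with the centre, which is within 1 of each. This keeps the
  supremum in \<open>d\<close> bounded.\<close>

lemma lip_le_2:
  assumes "lip \<psi>" "p \<in> H" "q \<in> H"
  shows "\<psi> q - \<psi> p \<le> 2"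
proof -
  obtain i t j u where p: "p = (i, t)" "i < s" "0 \<le> t" "t \<le> 1" and q: "q = (j, u)" "j < s" "0 \<le> u" "u \<le> 1"
    using assms(2,3) by (auto simp: preglued)
  have "\<psi> (i, 0) = \<psi> (j, 0)" using assms(1) centre[OF p(2) q(2)] by (auto simp: lip_def)
  moreover have "\<psi> (i, 0) \<le> \<psi> (i, t) + \<bar>0 - t\<bar>" "\<psi> (j, u) \<le> \<psi> (j, 0) + \<bar>u - 0\<bar>"
    by (rule lip_D[OF assms(1)]; use p q in \<open>simp add: preglued\<close>)+
  ultimately show ?thesis using p q by simp
qed

lemma d_ge: "lip \<psi> \<Longrightarrow> p \<in> H \<Longrightarrow> q \<in> H \<Longrightarrow> \<psi> q - \<psi> p \<le> d p q"
  unfolding d_def by (rule cSUP_upper) (auto intro!: bdd_aboveI[of _ 2] lip_le_2)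

lemma lip_const: "lip (\<lambda>_. c)"
  by (simp add: lip_def)

lemma d_le: "(\<And>\<psi>. lip \<psi> \<Longrightarrow> \<psi> q - \<psi> p \<le> c) \<Longrightarrow> d p q \<le> c"
  unfolding d_def by (rule cSUP_least) (use lip_const in auto)

lemma d_refl: "p \<in> H \<Longrightarrow> d p p = 0"
  using d_ge[OF lip_const[of 0], of p p] d_le[of p p 0] by simp

lemma d_nonneg: "p \<in> H \<Longrightarrow> q \<in> H \<Longrightarrow> 0 \<le> d p q"
  using d_ge[OF lip_const[of 0], of p q] by simp

lemma lip_uminus: "lip \<psi> \<Longrightarrow> lip (\<lambda>p. - \<psi> p)"
  unfolding lip_def by (auto simp: algebra_simps) (metis abs_minus_commute add.commute)

lemma d_sym_le: "p \<in> H \<Longrightarrow> q \<in> H \<Longrightarrow> d p q \<le> d q p"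
  using d_ge[OF lip_uminus, of _ q p] by (intro d_le) force

lemma d_sym: "p \<in> H \<Longrightarrow> q \<in> H \<Longrightarrow> d p q = d q p"
  by (intro antisym d_sym_le)

lemma d_triangle:
  assumes "p \<in> H" "q \<in> H" "r \<in> H"
  shows "d p r \<le> d p q + d q r"
proof (rule d_le)
  fix \<psi> assume "lip \<psi>"
  then show "\<psi> r - \<psi> p \<le> d p q + d q r"
    using d_ge[of \<psi> p q] d_ge[of \<psi> q r] assms by linarith
qed

text \<open>A supremum of potentials normalised at \<open>p\<close> is again a potential; the
  supremum defining \<open>d\<close> is therefore attained by \<open>d p\<close> itself.\<close>

lemma lip_d:
  assumes "p \<in> H" shows "lip (d p)"
  unfolding lip_def
proof (intro conjI allI impI ballI, goal_cases)
  case (1 i t u)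
  have "d (i, u) (i, t) \<le> \<bar>t - u\<bar>" by (rule d_le) (use lip_D 1 in force)
  then show ?case using d_triangle[OF assms 1(2) 1(1)] by linarith
next
  case (2 x)
  then obtain q r where x: "x = (q, r)" "(q, r) \<in> glue G" by (cases x) auto
  then have qr: "q \<in> H" "r \<in> H" using glue_subset by auto
  have "\<psi> q = \<psi> r" if "lip \<psi>" for \<psi> using that x by (auto simp: lip_def)
  then have "d q r \<le> 0" "d r q \<le> 0" by (metis d_le diff_self order_refl)+
  then have "d p q = d p r" using d_triangle[OF assms qr] d_triangle[OF assms qr(2) qr(1)] by linarith
  then show ?case by (simp add: x)
qed

text \<open>Weak duality: along a path a potential grows by at most the length travelled, and
  passing between identified positions leaves it unchanged.\<close>

lemma path_ge:
  assumes "path_of_length G X Y l" "lip \<psi>" "p \<in> X"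
  shows "q \<in> Y \<Longrightarrow> \<psi> q - \<psi> p \<le> l"
  using assms
proof (induction arbitrary: q rule: path_of_length.induct)
  case (stay X)
  then obtain x where "X = ident G `` {x}" by (auto elim: pointsE)
  then have "\<psi> p = \<psi> x" "\<psi> q = \<psi> x"
    using stay.prems lip_ident[OF stay.prems(2)] by (metis Image_singleton_iff)+
  then show ?case by simp
next
  case (move X Y l e t u)
  have "Y \<in> points G" using path_points move.hyps(1) by blast
  then have "(e, t) \<in> H" using move.hyps(2) ident_subset by (blast elim: pointsE)
  then have "\<psi> (e, u) \<le> \<psi> (e, t) + \<bar>u - t\<bar>" using lip_D move by blast
  moreover have "\<psi> (e, t) - \<psi> p \<le> l" using move by blast
  moreover have "\<psi> q = \<psi> (e, u)" using lip_ident[OF move.prems(2)] move.prems(1) by (metis Image_singleton_iff)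
  ultimately show ?case by linarith
qed

lemma path_le_2:
  assumes "p \<in> H" "q \<in> H"
  shows "\<exists>l \<le> 2. path_of_length G (ident G `` {p}) (ident G `` {q}) l"
proof -
  obtain i t j u where p: "p = (i, t)" "i < s" "0 \<le> t" "t \<le> 1" and q: "q = (j, u)" "j < s" "0 \<le> u" "u \<le> 1"
    using assms by (auto simp: preglued)
  have "((i, 0), (j, 0)) \<in> ident G"
    using centre[OF p(2) q(2)] p q by (auto simp: ident_def preglued)
  then have "path_of_length G (ident G `` {p}) (ident G `` {q}) (\<bar>0 - t\<bar> + \<bar>u - 0\<bar>)"
    using path_through[of i t G j u 0 0] assms by (simp add: p q)
  then show ?thesis using p q by (intro exI[of _ "\<bar>0 - t\<bar> + \<bar>u - 0\<bar>"]) simp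
qed

lemma d_le_diam:
  assumes "p \<in> H" "q \<in> H"
  shows "d p q \<le> diam G"
proof -
  let ?X = "ident G `` {p}" and ?Y = "ident G `` {q}"
  have "d p q \<le> graph_dist G ?X ?Y"
    unfolding graph_dist_def
  proof (rule cInf_greatest)
    show "{l. path_of_length G ?X ?Y l} \<noteq> {}" using path_le_2[OF assms] by blast
    fix l assume "l \<in> {l. path_of_length G ?X ?Y l}"
    then have "d p q - d p p \<le> l"
      by (intro path_ge[OF _ lip_d]) (auto simp: assms ident_refl)
    then show "d p q \<le> l" by (simp add: d_refl assms)
  qed
  also have "graph_dist G ?X ?Y \<le> diam G"
    unfolding diam_def
  proof (rule cSUP_upper2[where x = "(?X, ?Y)"])
    show "bdd_above ((\<lambda>(X, Y). graph_dist G X Y) ` (points G \<times> points G))"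
    proof (rule bdd_aboveI2, clarify)
      fix X Y assume XY: "X \<in> points G" "Y \<in> points G"
      obtain p where "p \<in> H" "X = ident G `` {p}" using XY(1) by (rule pointsE)
      moreover obtain q where "q \<in> H" "Y = ident G `` {q}" using XY(2) by (rule pointsE)
      ultimately obtain l where "l \<le> 2" "path_of_length G X Y l" using path_le_2 by blast
      then show "graph_dist G X Y \<le> 2" using graph_dist_le by force
    qed
  qed (auto simp: assms class_in_points)
  finally show ?thesis .
qed

text \<open>The condition \<open>p \<noteq> q\<close> discards pairs gluing a position to itself, as
  in a wormhole joining a point to itself. They identify nothing and could put a leaf at the end of
  the core.\<close>

definition glued :: "(nat \<times> real) set" where
  "glued = {p. \<exists>q. p \<noteq> q \<and> ((p, q) \<in> glue G \<or> (q, p) \<in> glue G)}"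

definition top :: "nat \<Rightarrow> real" where "top i = Max {t. (i, t) \<in> glued}"

definition core :: "(nat \<times> real) set" where "core = {(i, t). i < s \<and> 0 \<le> t \<and> t \<le> top i}"

lemma finite_glued: "finite glued"
proof (rule finite_subset)
  show "glued \<subseteq> fst ` glue G \<union> snd ` glue G" by (force simp: glued_def)
qed (simp add: finite_glue)

lemma glued_subset: "glued \<subseteq> H"
  using glue_subset by (auto simp: glued_def)

lemma finite_slice: "finite F \<Longrightarrow> finite {t. (i, t) \<in> F}"
  using finite_vimageI[of F "Pair i"] by (simp add: vimage_def inj_on_def)

lemma centre_glued:
  assumes "i < s" shows "(i, 0) \<in> glued"
proof -
  define j where "j = (if i = 0 then 1 else 0 :: nat)"
  have "j < s" "j \<noteq> i" using two by (auto simp: j_def)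
  then show ?thesis using centre[OF assms \<open>j < s\<close>]
    unfolding glued_def by (intro CollectI exI[of _ "(j, 0)"]) simp
qed

lemma top_glued: "i < s \<Longrightarrow> (i, top i) \<in> glued"
  using Max_in[OF finite_slice[OF finite_glued], of i] centre_glued by (auto simp: top_def)

lemma le_top: "(i, t) \<in> glued \<Longrightarrow> t \<le> top i"
  unfolding top_def by (intro Max_ge finite_slice finite_glued) simp

lemma top_bounds: "i < s \<Longrightarrow> 0 \<le> top i" "i < s \<Longrightarrow> top i \<le> 1"
  using top_glued[of i] glued_subset le_top[OF centre_glued, of i] by (auto simp: preglued)

lemma glued_core: "glued \<subseteq> core"
  using glued_subset le_top by (auto simp: core_def preglued)

lemma core_subset: "core \<subseteq> H"
  by (auto simp: core_def preglued dest: top_bounds(2))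

text \<open>\<open>d a\<close> is continuous and the core is a finite union of compact intervals. An
  exact maximum is wanted because it makes all edges at \<open>y\<close> descend towards
  \<open>a\<close>.\<close>

lemma core_farthest:
  assumes "a \<in> core"
  obtains y where "y \<in> core" "\<And>z. z \<in> core \<Longrightarrow> d a z \<le> d a y"
proof -
  have aH: "a \<in> H" using assms core_subset by blast
  have "\<exists>u\<in>{0..top i}. \<forall>t\<in>{0..top i}. d a (i, t) \<le> d a (i, u)" if "i < s" for i
  proof (rule continuous_attains_sup)
    show "{0..top i} \<noteq> {}" using top_bounds that by auto
    show "continuous_on {0..top i} (\<lambda>t. d a (i, t))"
    proof (rule lipschitz_on_continuous_on[of 1], rule lipschitz_onI)
      fix t u assume "t \<in> {0..top i}" "u \<in> {0..top i}"
      then have "(i, t) \<in> H" "(i, u) \<in> H" using top_bounds[OF that] that by (auto simp: preglued)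
      then show "dist (d a (i, t)) (d a (i, u)) \<le> 1 * dist t u"
        using lip_D[OF lip_d[OF aH], of i t u] lip_D[OF lip_d[OF aH], of i u t]
        by (simp add: dist_real_def abs_le_iff abs_minus_commute)
    qed simp
  qed simp
  then obtain \<tau> where \<tau>: "\<And>i. i < s \<Longrightarrow> \<tau> i \<in> {0..top i}"
    "\<And>i t. i < s \<Longrightarrow> t \<in> {0..top i} \<Longrightarrow> d a (i, t) \<le> d a (i, \<tau> i)" by metis
  let ?M = "(\<lambda>i. d a (i, \<tau> i)) ` {..<s}"
  have M: "finite ?M" "?M \<noteq> {}" using two by (auto simp: lessThan_empty_iff)
  then have "Max ?M \<in> ?M" by (rule Max_in)
  then obtain j where j: "j < s" "Max ?M = d a (j, \<tau> j)" by blast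
  show ?thesis
  proof (rule that[of "(j, \<tau> j)"])
    show "(j, \<tau> j) \<in> core" using \<tau>(1)[OF j(1)] j by (simp add: core_def)
    fix z assume "z \<in> core"
    then obtain i t where z: "z = (i, t)" "i < s" "t \<in> {0..top i}" by (auto simp: core_def)
    have "d a z \<le> d a (i, \<tau> i)" using \<tau>(2) z by simp
    also have "\<dots> \<le> Max ?M" using z by (intro Max_ge M) auto
    finally show "d a z \<le> d a (j, \<tau> j)" by (simp add: j)
  qed
qed

end

section \<open>The core as a multigraph\<close>

text \<open>The gaps telescope: removing the maximum leaves the predecessors of all other elements
  unchanged.\<close>

lemma sum_consecutive_differences:
  fixes S :: "real set"
  assumes "finite S" "0 \<in> S" "\<And>t. t \<in> S \<Longrightarrow> 0 \<le> t"
  shows "(\<Sum>t\<in>S - {0}. t - Max {u \<in> S. u < t}) = Max S"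
  using assms
proof (induction "card S" arbitrary: S rule: less_induct)
  case less
  show ?case
  proof (cases "S = {0}")
    case False
    let ?m = "Max S" and ?S = "S - {Max S}"
    have m: "?m \<in> S" using less.prems by (intro Max_in) auto
    obtain t where "t \<in> S" "t \<noteq> 0" using False less.prems by blast
    then have "0 < ?m" using less.prems(1) less.prems(3)[of t] Max_ge[of S t] by linarith
    then have z: "0 \<in> ?S" using less.prems by simp
    have below: "{u \<in> S. u < ?m} = ?S"
      by (auto simp: order_less_le intro: Max_ge[OF less.prems(1)])
    have same: "{u \<in> S. u < t} = {u \<in> ?S. u < t}" if "t \<in> ?S" for t
      using that Max_ge[OF less.prems(1), of t] by auto
    have "(\<Sum>t\<in>S - {0}. t - Max {u \<in> S. u < t})
        = (?m - Max {u \<in> S. u < ?m}) + (\<Sum>t\<in>S - {0} - {?m}. t - Max {u \<in> S. u < t})"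
      using less.prems m \<open>0 < ?m\<close> by (intro sum.remove) auto
    also have "S - {0} - {?m} = ?S - {0}" by blast
    also have "(\<Sum>t\<in>?S - {0}. t - Max {u \<in> S. u < t}) = (\<Sum>t\<in>?S - {0}. t - Max {u \<in> ?S. u < t})"
      using same by (intro sum.cong refl) auto
    also have "\<dots> = Max ?S"
      using less.prems z m card_gt_0_iff[of S] by (intro less.hyps) auto
    finally show ?thesis by (simp only: below)
  qed simp
qed

text \<open>Marks cut the core into edges. Besides the glued points, \<open>F\<close> is meant to
  hold \<open>a\<close> and \<open>y\<close>, which may lie inside edges and thus become vertices.
  By \<open>top_pos\<close> an edge leaves the centre along every spike.\<close>

locale marked_star = glued_star +
  fixes F :: "(nat \<times> real) set"
  assumes finite_F: "finite F" and glued_F: "glued \<subseteq> F" and F_core: "F \<subseteq> core"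
    and top_pos: "i < s \<Longrightarrow> 0 < top i"
begin

lemma glue_imp_F: "(p, q) \<in> glue G \<Longrightarrow> p \<noteq> q \<Longrightarrow> p \<in> F \<and> q \<in> F"
  using glued_F glued_def by (metis (mono_tags, lifting) mem_Collect_eq subsetD)

lemma F_H: "F \<subseteq> H"
  using F_core core_subset by blast

lemma zero_F: "i < s \<Longrightarrow> (i, 0) \<in> F"
  using centre_glued glued_F by blast

text \<open>The McShane extension, spike by spike: the largest 1-Lipschitz continuation of Lipschitz
  values at the marks.\<close>

definition ext :: "(nat \<times> real \<Rightarrow> real) \<Rightarrow> nat \<times> real \<Rightarrow> real" where
  "ext \<phi> p = Min ((\<lambda>u. \<phi> (fst p, u) + \<bar>snd p - u\<bar>) ` {u. (fst p, u) \<in> F})"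

definition lip_on_marks :: "(nat \<times> real \<Rightarrow> real) \<Rightarrow> bool" where
  "lip_on_marks \<phi> \<longleftrightarrow>
     (\<forall>i t u. (i, t) \<in> F \<longrightarrow> (i, u) \<in> F \<longrightarrow> \<phi> (i, t) \<le> \<phi> (i, u) + \<bar>t - u\<bar>)
     \<and> (\<forall>(p, q) \<in> glue G. \<phi> p = \<phi> q)"

lemma lip_imp_lip_on_marks: "lip \<phi> \<Longrightarrow> lip_on_marks \<phi>"
  using F_H unfolding lip_def lip_on_marks_def by (meson subsetD)

lemma ext_le: "(i, u) \<in> F \<Longrightarrow> ext \<phi> (i, t) \<le> \<phi> (i, u) + \<bar>t - u\<bar>"
  unfolding ext_def by (intro Min_le) (auto simp: finite_slice finite_F)

lemma ext_ge:
  assumes "i < s" "\<And>u. (i, u) \<in> F \<Longrightarrow> c \<le> \<phi> (i, u) + \<bar>t - u\<bar>"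
  shows "c \<le> ext \<phi> (i, t)"
  unfolding ext_def using zero_F[OF assms(1)] assms(2)
  by (subst Min_ge_iff) (auto simp: finite_slice finite_F)

lemma ext_eq:
  assumes "lip_on_marks \<phi>" "p \<in> F"
  shows "ext \<phi> p = \<phi> p"
proof -
  obtain i t where p: "p = (i, t)" by fastforce
  have "i < s" using assms(2) F_core by (auto simp: core_def p)
  then have "\<phi> (i, t) \<le> ext \<phi> (i, t)"
    by (rule ext_ge) (use assms in \<open>auto simp: lip_on_marks_def p\<close>)
  moreover have "ext \<phi> (i, t) \<le> \<phi> (i, t)" using ext_le[of i t \<phi> t] assms(2) by (simp add: p)
  ultimately show ?thesis by (simp add: p)
qed

text \<open>Distinct glued positions are marks, where \<open>ext\<close> keeps the given values, so
  compatibility with the gluing is inherited.\<close>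

lemma lip_ext:
  assumes "lip_on_marks \<phi>"
  shows "lip (ext \<phi>)"
  unfolding lip_def
proof (intro conjI allI impI ballI, goal_cases)
  case (1 i t u)
  have "ext \<phi> (i, t) - \<bar>t - u\<bar> \<le> ext \<phi> (i, u)"
  proof (rule ext_ge)
    show "i < s" using 1 by (simp add: preglued)
    fix v assume "(i, v) \<in> F"
    then have "ext \<phi> (i, t) \<le> \<phi> (i, v) + \<bar>t - v\<bar>" by (rule ext_le)
    then show "ext \<phi> (i, t) - \<bar>t - u\<bar> \<le> \<phi> (i, v) + \<bar>u - v\<bar>" by linarith
  qed
  then show ?case by linarith
next
  case (2 x)
  obtain p q where x: "x = (p, q)" by (cases x)
  have "ext \<phi> p = ext \<phi> q"
  proof (cases "p = q")
    case False
    then have "p \<in> F" "q \<in> F" using 2 glue_imp_F by (auto simp: x)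
    then show ?thesis
      using assms 2 by (simp add: ext_eq[OF assms]) (auto simp: lip_on_marks_def x)
  qed simp
  then show ?case by (simp add: x)
qed

section \<open>Segments between consecutive marks\<close>

definition prev :: "nat \<times> real \<Rightarrow> nat \<times> real" where
  "prev p = (fst p, Max {u. (fst p, u) \<in> F \<and> u < snd p})"

text \<open>The edge between two consecutive marks is represented by its outer end.\<close>

definition segments :: "(nat \<times> real) set" where
  "segments = {p \<in> F. 0 < snd p}"

definition seg_len :: "nat \<times> real \<Rightarrow> real" where
  "seg_len p = snd p - snd (prev p)"

lemma prevE:
  assumes "p \<in> segments"
  obtains i t u where "p = (i, t)" "prev p = (i, u)" "i < s" "(i, t) \<in> F" "(i, u) \<in> F" "0 \<le> u" "u < t"
    "seg_len p = t - u" "\<And>v. (i, v) \<in> F \<Longrightarrow> v \<le> u \<or> t \<le> v"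
proof -
  obtain i t where p: "p = (i, t)" by fastforce
  then have it: "(i, t) \<in> F" "0 < t" using assms by (auto simp: segments_def)
  then have i: "i < s" using F_core by (auto simp: core_def)
  define S where "S = {v. (i, v) \<in> F \<and> v < t}"
  have "finite S" unfolding S_def using finite_slice[OF finite_F, of i] by (rule rev_finite_subset) auto
  have "0 \<in> S" using zero_F[OF i] it by (simp add: S_def)
  then have "Max S \<in> S" using \<open>finite S\<close> by (intro Max_in) auto
  moreover have "v \<le> Max S \<or> t \<le> v" if "(i, v) \<in> F" for v
    using that \<open>finite S\<close> by (cases "v < t") (auto simp: S_def)
  moreover have "0 \<le> Max S" using \<open>0 \<in> S\<close> \<open>finite S\<close> by simp
  ultimately show ?thesis
    using i it by (intro that[of i t "Max S"]) (auto simp: p prev_def seg_len_def S_def)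
qed

lemma next_segment:
  assumes "(i, u) \<in> F" "(i, v) \<in> F" "u < v"
  obtains t where "(i, t) \<in> segments" "prev (i, t) = (i, u)" "t \<le> v"
proof -
  define S where "S = {t. (i, t) \<in> F \<and> u < t}"
  have S: "finite S" "v \<in> S"
    unfolding S_def using finite_slice[OF finite_F, of i] assms by (auto elim: rev_finite_subset)
  have m: "Min S \<in> S" using S by (intro Min_in) auto
  have u: "0 \<le> u" using assms(1) F_core by (auto simp: core_def)
  have seg: "(i, Min S) \<in> segments" using m u by (auto simp: segments_def S_def)
  then obtain w where w: "prev (i, Min S) = (i, w)" "(i, w) \<in> F" "w < Min S"
    "\<And>v. (i, v) \<in> F \<Longrightarrow> v \<le> w \<or> Min S \<le> v"
    by (auto elim!: prevE)
  have "u < Min S" using m by (simp add: S_def)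
  then have "u \<le> w" using w(4) assms(1) by force
  moreover have "\<not> u < w" using w Min_le[OF S(1), of w] by (auto simp: S_def)
  ultimately show ?thesis using that[OF seg] w S by simp
qed

text \<open>Vertices are chosen positions rather than classes, so that functions on positions, such
  as \<open>d a\<close>, are directly functions on vertices.\<close>

definition rep :: "nat \<times> real \<Rightarrow> nat \<times> real" where
  "rep p = (SOME q. (p, q) \<in> ident G)"

lemma rep_ident: "p \<in> H \<Longrightarrow> (p, rep p) \<in> ident G"
  unfolding rep_def by (rule someI[of _ p]) (rule ident_refl)

lemma rep_eq_iff:
  assumes "p \<in> H" "q \<in> H"
  shows "rep p = rep q \<longleftrightarrow> (p, q) \<in> ident G"
proof
  assume "rep p = rep q"
  then show "(p, q) \<in> ident G" by (metis assms ident_sym ident_trans rep_ident)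
next
  assume "(p, q) \<in> ident G"
  then have "(p, r) \<in> ident G \<longleftrightarrow> (q, r) \<in> ident G" for r by (metis ident_sym ident_trans)
  then show "rep p = rep q" by (simp add: rep_def)
qed

lemma lip_rep: "lip \<phi> \<Longrightarrow> p \<in> H \<Longrightarrow> \<phi> (rep p) = \<phi> p"
  using lip_ident rep_ident by metis

lemma finite_segments: "finite segments"
  by (simp add: segments_def finite_F)

text \<open>A glued mark has an edge end at each of two identified positions. An unglued mark lies
  strictly between the centre and \<open>top\<close> and has an edge on either side.\<close>

lemma two_ends:
  assumes "p \<in> F"
  shows "2 \<le> card {e \<in> segments. (rep \<circ> prev) e = rep p} + card {e \<in> segments. rep e = rep p}"
proof -
  let ?S = "{e \<in> segments. (rep \<circ> prev) e = rep p}" and ?T = "{e \<in> segments. rep e = rep p}"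
  \<comment> \<open>\<open>Inl\<close> stands for the inner end of an edge and \<open>Inr\<close>
    for the outer one, so a loop counts twice. Ends at different positions are distinct.\<close>
  define mark where "mark x = (case x of Inl e \<Rightarrow> prev e | Inr e \<Rightarrow> e)" for x :: "(nat \<times> real) + (nat \<times> real)"
  have fin: "finite ?S" "finite ?T" using finite_segments by auto
  have some: "\<exists>x \<in> ?S <+> ?T. mark x = q" if q: "q \<in> F" "rep q = rep p" for q
  proof -
    obtain i t where it: "q = (i, t)" "i < s" "0 \<le> t" using q(1) F_core by (force simp: core_def)
    show ?thesis
    proof (cases "t = 0")
      case True
      have "(i, top i) \<in> F" using top_glued[OF it(2)] glued_F by blast
      then obtain u where u: "(i, u) \<in> segments" "prev (i, u) = (i, t)"
        using next_segment[of i t "top i"] top_pos[OF it(2)] q it True by blast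
      then have "Inl (i, u) \<in> ?S <+> ?T" "mark (Inl (i, u)) = q" using q it by (auto simp: mark_def)
      then show ?thesis by blast
    next
      case False
      then have "Inr q \<in> ?S <+> ?T" "mark (Inr q) = q" using q it by (auto simp: segments_def mark_def)
      then show ?thesis by blast
    qed
  qed
  have "\<exists>x y. x \<in> ?S <+> ?T \<and> y \<in> ?S <+> ?T \<and> x \<noteq> y"
  proof (cases "p \<in> glued")
    case True
    then obtain q where q: "p \<noteq> q" "(p, q) \<in> glue G \<or> (q, p) \<in> glue G" by (auto simp: glued_def)
    then have "q \<in> glued" unfolding glued_def by (intro CollectI exI[of _ p]) auto
    then have qF: "q \<in> F" using glued_F by blast
    have "(q, p) \<in> (glue G \<union> (glue G)\<inverse>)\<^sup>*" using q by (intro r_into_rtrancl) auto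
    then have "(q, p) \<in> ident G" using qF assms F_H by (auto simp: ident_def)
    then have "rep q = rep p" using rep_eq_iff qF assms F_H by blast
    then obtain x y where "x \<in> ?S <+> ?T" "mark x = p" "y \<in> ?S <+> ?T" "mark y = q"
      using some[OF assms] some[OF qF] by blast
    then show ?thesis using q(1) by (intro exI[of _ x] exI[of _ y]) auto
  next
    case False
    obtain i t where it: "p = (i, t)" "i < s" "0 \<le> t" "t \<le> top i" using assms F_core by (force simp: core_def)
    have "t \<noteq> 0" "t \<noteq> top i" using False centre_glued[OF it(2)] top_glued[OF it(2)] it by auto
    moreover have "(i, top i) \<in> F" using top_glued[OF it(2)] glued_F by blast
    ultimately obtain u where u: "(i, u) \<in> segments" "prev (i, u) = (i, t)"
      using next_segment[of i t "top i"] assms it by force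
    then have "Inl (i, u) \<in> ?S <+> ?T" using it by auto
    moreover have "Inr p \<in> ?S <+> ?T" using assms it \<open>t \<noteq> 0\<close> by (auto simp: segments_def)
    ultimately show ?thesis by blast
  qed
  then obtain x y where xy: "{x, y} \<subseteq> ?S <+> ?T" "x \<noteq> y" by blast
  have "card {x, y} \<le> card (?S <+> ?T)" using xy fin by (intro card_mono) auto
  then show ?thesis using xy fin by (simp add: card_Plus)
qed

sublocale leafless_multigraph segments "rep ` F" "rep \<circ> prev" rep seg_len
proof
  show "finite segments" by (rule finite_segments)
  show "finite (rep ` F)" by (simp add: finite_F)
  fix e assume e: "e \<in> segments"
  then show "rep e \<in> rep ` F" by (auto simp: segments_def)
  show "(rep \<circ> prev) e \<in> rep ` F" "0 < seg_len e" using e by (auto elim!: prevE)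
next
  fix v assume "v \<in> rep ` F"
  then show "2 \<le> card {e \<in> segments. (rep \<circ> prev) e = v} + card {e \<in> segments. rep e = v}"
    using two_ends by blast
qed

lemma segment_rep:
  assumes "lip \<phi>" "e \<in> segments"
  shows "\<phi> (rep e) = \<phi> e" "\<phi> ((rep \<circ> prev) e) = \<phi> (prev e)"
  using assms F_H by (auto intro!: lip_rep elim!: prevE)

text \<open>Otherwise the value at the class of \<open>p\<close> could be increased, against the maximality of \<open>d a p\<close>.\<close>

lemma exists_tight_mark:
  assumes a: "a \<in> F" and p: "p \<in> F" "(p, a) \<notin> ident G"
  obtains i t u where "(i, t) \<in> F" "((i, t), p) \<in> ident G" "(i, u) \<in> F" "u \<noteq> t"
    "d a (i, t) = d a (i, u) + \<bar>t - u\<bar>"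
proof (rule ccontr)
  assume contr: "\<not> thesis"
  note witness = that
  have aH: "a \<in> H" using a F_H by blast
  note lipa = lip_d[OF aH]
  \<comment> \<open>Pairs of a position in the class of \<open>p\<close> and another mark on its
    spike; \<open>gap\<close> measures the slack in their Lipschitz condition.\<close>
  define P where "P = {(q, r). q \<in> F \<and> r \<in> F \<and> fst q = fst r \<and> snd r \<noteq> snd q \<and> (q, p) \<in> ident G}"
  define gap where "gap = (\<lambda>(q, r). d a r + \<bar>snd q - snd r\<bar> - d a q)"
  have "finite P" by (rule finite_subset[of _ "F \<times> F"]) (auto simp: P_def finite_F)
  have gap_pos: "0 < gap x" if "x \<in> P" for x
  proof -
    obtain i t u where x: "x = ((i, t), (i, u))" "(i, t) \<in> F" "(i, u) \<in> F" "u \<noteq> t" "((i, t), p) \<in> ident G"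
      using \<open>x \<in> P\<close> by (auto simp: P_def)
    then have "d a (i, t) \<le> d a (i, u) + \<bar>t - u\<bar>" using lip_D[OF lipa] F_H by blast
    moreover have "d a (i, t) \<noteq> d a (i, u) + \<bar>t - u\<bar>" using contr witness x by blast
    ultimately show ?thesis by (simp add: gap_def x)
  qed
  \<comment> \<open>The inserted 1 provides for an empty \<open>P\<close>.\<close>
  define \<delta> where "\<delta> = Min (insert 1 (gap ` P))"
  have \<delta>: "0 < \<delta>" "\<And>x. x \<in> P \<Longrightarrow> \<delta> \<le> gap x"
    using \<open>finite P\<close> gap_pos by (auto simp: \<delta>_def)
  define \<phi> where "\<phi> q = d a q + (if (q, p) \<in> ident G then \<delta> else 0)" for q
  have "lip_on_marks \<phi>"
    unfolding lip_on_marks_def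
  proof (intro conjI allI impI ballI, goal_cases)
    case (1 i t u)
    have "d a (i, t) \<le> d a (i, u) + \<bar>t - u\<bar>" using 1 lip_D[OF lipa] F_H by blast
    moreover have "d a (i, t) + \<delta> \<le> d a (i, u) + \<bar>t - u\<bar>" if "((i, t), p) \<in> ident G" "u \<noteq> t"
      using \<delta>(2)[of "((i, t), (i, u))"] that 1 by (simp add: P_def gap_def)
    ultimately show ?case using \<delta>(1) by (auto simp: \<phi>_def)
  next
    case (2 x)
    obtain q r where x: "x = (q, r)" by (cases x)
    have "d a q = d a r" using 2 lipa by (auto simp: lip_def x)
    moreover have "(q, r) \<in> ident G" using 2 glue_subset by (auto simp: x ident_def)
    then have "(q, p) \<in> ident G \<longleftrightarrow> (r, p) \<in> ident G" by (metis ident_sym ident_trans)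
    ultimately show ?case by (simp add: x \<phi>_def)
  qed
  then have "\<phi> p - \<phi> a \<le> d a p"
    using d_ge[OF lip_ext, of \<phi> a p] ext_eq[of \<phi>] a p(1) F_H by auto
  moreover have "(p, p) \<in> ident G" using p F_H by (auto intro: ident_refl)
  moreover have "(a, p) \<notin> ident G" using p(2) ident_sym by blast
  ultimately show False using \<delta>(1) by (simp add: \<phi>_def d_refl aH)
qed

text \<open>The mark \<open>(i, u)\<close> from \<open>exists_tight_mark\<close> need not be
  adjacent to \<open>(i, t)\<close>. Equality over the whole stretch forces equality on the segment
  next to \<open>(i, t)\<close>, as both pieces obey the Lipschitz bound.\<close>

lemma exists_tight:
  assumes a: "a \<in> F" and p: "p \<in> F" "rep p \<noteq> rep a"
  shows "\<exists>e. tight (d a) (rep p) e"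
proof -
  have aH: "a \<in> H" using a F_H by blast
  note lipa = lip_d[OF aH]
  have "(p, a) \<notin> ident G" using a p rep_eq_iff F_H by blast
  then obtain i t u where itu: "(i, t) \<in> F" "((i, t), p) \<in> ident G" "(i, u) \<in> F" "u \<noteq> t"
    and eq: "d a (i, t) = d a (i, u) + \<bar>t - u\<bar>"
    by (rule exists_tight_mark[OF a p(1)])
  have rep: "rep (i, t) = rep p" using itu(1,2) p F_H rep_eq_iff by blast
  then have dp: "d a (rep p) = d a (i, t)" using lip_rep[OF lipa] itu(1) F_H by (metis subsetD)
  show ?thesis
  proof (cases "u < t")
    case True
    moreover have "0 \<le> u" using itu(3) F_core by (auto simp: core_def)
    ultimately have e: "(i, t) \<in> segments" using itu by (simp add: segments_def)
    then obtain v where v: "prev (i, t) = (i, v)" "(i, v) \<in> F" "v < t" "seg_len (i, t) = t - v"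
      "u \<le> v" using True itu(3) by (auto elim!: prevE)
    have "d a (i, v) \<le> d a (i, u) + \<bar>v - u\<bar>" "d a (i, t) \<le> d a (i, v) + \<bar>t - v\<bar>"
      using lip_D[OF lipa] itu v F_H by blast+
    then have "d a (i, t) = d a (i, v) + (t - v)" using eq v True by linarith
    then have "tight (d a) (rep p) (i, t)"
      using e rep dp v segment_rep(2)[OF lipa e] by (simp add: tight_def)
    then show ?thesis by blast
  next
    case False
    then have "t < u" using itu(4) by simp
    then obtain v where e: "(i, v) \<in> segments" and v: "prev (i, v) = (i, t)" "v \<le> u"
      using next_segment[OF itu(1,3)] by blast
    have vF: "(i, v) \<in> F" "t < v" "seg_len (i, v) = v - t" using e v by (auto elim!: prevE)
    have "d a (i, v) \<le> d a (i, u) + \<bar>v - u\<bar>" "d a (i, t) \<le> d a (i, v) + \<bar>t - v\<bar>"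
      using lip_D[OF lipa] itu vF F_H by blast+
    then have "d a (i, t) = d a (i, v) + (v - t)" using eq v vF by linarith
    then have "tight (d a) (rep p) (i, v)"
      using e rep dp v vF segment_rep(1)[OF lipa e] by (simp add: tight_def)
    then show ?thesis by blast
  qed
qed

lemma distance_from_d:
  assumes a: "a \<in> F"
  shows "distance_from (rep a) (d a)"
proof -
  have aH: "a \<in> H" using a F_H by blast
  note lipa = lip_d[OF aH]
  have "\<bar>d a ((rep \<circ> prev) e) - d a (rep e)\<bar> \<le> seg_len e" if e: "e \<in> segments" for e
  proof -
    obtain i t u where e': "e = (i, t)" "prev e = (i, u)" "(i, t) \<in> F" "(i, u) \<in> F" "u < t" "seg_len e = t - u"
      using e by (rule prevE)
    have "d a (i, t) \<le> d a (i, u) + \<bar>t - u\<bar>" "d a (i, u) \<le> d a (i, t) + \<bar>u - t\<bar>"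
      using lip_D[OF lipa] e' F_H by blast+
    then show ?thesis using segment_rep[OF lipa e] e' by simp
  qed
  moreover have "0 \<le> d a (rep p)" if "p \<in> F" for p
    using that lip_rep[OF lipa, of p] d_nonneg[OF aH, of p] F_H by auto
  moreover have "d a (rep a) = 0" using lip_rep[OF lipa aH] d_refl[OF aH] by simp
  ultimately show ?thesis
    using a exists_tight[OF a] by (auto simp: distance_from_def)
qed

text \<open>The extension of \<open>d a\<close> from the marks is a potential, hence a lower bound
  for \<open>d a\<close>. This turns bounds on distances in the core into bounds on
  \<open>apex\<close>.\<close>

lemma apex_attained:
  assumes a: "a \<in> F" and e: "e \<in> segments"
  shows "\<exists>z \<in> core. apex (d a) e \<le> d a z"
proof -
  have aH: "a \<in> H" using a F_H by blast
  note lipa = lip_d[OF aH]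
  obtain i t u where e': "e = (i, t)" "prev e = (i, u)" "i < s" "(i, t) \<in> F" "(i, u) \<in> F" "0 \<le> u" "u < t"
    "seg_len e = t - u" and gap: "\<And>v. (i, v) \<in> F \<Longrightarrow> v \<le> u \<or> t \<le> v"
    using e by (elim prevE) blast
  have lip: "d a (i, v) \<le> d a (i, w) + \<bar>v - w\<bar>" if "(i, v) \<in> F" "(i, w) \<in> F" for v w
    using lip_D[OF lipa] that F_H by blast
  \<comment> \<open>The balance point of the edge: continuing with slope 1 from either end gives the
    same value, \<open>apex\<close>.\<close>
  define x where "x = u + (d a (i, t) - d a (i, u) + (t - u)) / 2"
  have x: "u \<le> x" "x \<le> t"
    using lip[OF e'(4,5)] lip[OF e'(5,4)] e'(7) by (auto simp: x_def field_simps)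
  have apex: "apex (d a) e = (d a (i, u) + d a (i, t) + (t - u)) / 2"
    using segment_rep[OF lipa e] e' by (simp add: apex_def)
  have m: "lip_on_marks (d a)" by (rule lip_imp_lip_on_marks[OF lipa])
  have "apex (d a) e \<le> ext (d a) (i, x)"
  proof (rule ext_ge[OF e'(3)])
    fix v assume v: "(i, v) \<in> F"
    show "apex (d a) e \<le> d a (i, v) + \<bar>x - v\<bar>"
      using gap[OF v] lip[OF e'(5) v] lip[OF e'(4) v] x unfolding apex
      by (elim disjE) (simp_all add: x_def field_simps)
  qed
  moreover have xc: "(i, x) \<in> core" using x e' F_core by (auto simp: core_def)
  then have "(i, x) \<in> H" using core_subset by blast
  then have "ext (d a) (i, x) - ext (d a) a \<le> d a (i, x)" by (rule d_ge[OF lip_ext[OF m] aH])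
  ultimately have "apex (d a) e \<le> d a (i, x)" using ext_eq[OF m a] d_refl[OF aH] by simp
  then show ?thesis using xc by blast
qed

lemma sum_seg_len: "sum seg_len segments = (\<Sum>i<s. top i)"
proof -
  have slice: "(\<Sum>t\<in>{t. (i, t) \<in> segments}. seg_len (i, t)) = top i" if i: "i < s" for i
  proof -
    let ?S = "{t. (i, t) \<in> F}"
    have fin: "finite ?S" by (rule finite_slice[OF finite_F])
    have pos: "0 \<le> t" "t \<le> top i" if "t \<in> ?S" for t using that F_core by (auto simp: core_def)
    have "Max ?S = top i"
      using top_glued[OF i] glued_F pos fin by (intro Max_eqI) auto
    have "{t. (i, t) \<in> segments} = ?S - {0}" using pos by (force simp: segments_def)
    then have "(\<Sum>t\<in>{t. (i, t) \<in> segments}. seg_len (i, t)) = (\<Sum>t\<in>?S - {0}. t - Max {u \<in> ?S. u < t})"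
      by (simp add: seg_len_def prev_def)
    also have "\<dots> = Max ?S"
      using fin zero_F[OF i] pos by (intro sum_consecutive_differences) auto
    finally show ?thesis by (simp add: \<open>Max ?S = top i\<close>)
  qed
  have "segments = (SIGMA i:{..<s}. {t. (i, t) \<in> segments})"
    using F_core by (auto simp: segments_def core_def)
  then have "sum seg_len segments = sum seg_len (SIGMA i:{..<s}. {t. (i, t) \<in> segments})" by simp
  also have "\<dots> = (\<Sum>i<s. \<Sum>t\<in>{t. (i, t) \<in> segments}. seg_len (i, t))"
    using finite_slice[OF finite_segments] by (subst sum.Sigma) auto
  finally show ?thesis using slice by simp
qed

text \<open>There is one segment for each mark except the \<open>s\<close> positions at the centre,
  while by \<open>merge\<close> at least \<open>card F + 1 - s - k\<close> classes of marks
  remain.\<close>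

lemma card_segments_le: "real (card segments) \<le> real (card (rep ` F)) - 1 + real k"
proof -
  obtain g :: "nat \<times> real \<Rightarrow> nat \<times> real"
    where g: "\<forall>(p, q) \<in> glue G. g p = g q" and c: "card F + 1 \<le> card (g ` F) + s + k"
    using merge[OF F_H finite_F zero_F] by blast
  have "g (rep p) = g p" if "p \<in> F" for p
    by (rule ident_invariant[of G g p "rep p", symmetric]) (use that g F_H rep_ident[of p] in auto)
  then have "g ` F = g ` rep ` F" by (auto simp: image_image)
  then have "card (g ` F) \<le> card (rep ` F)" by (simp add: card_image_le finite_F)
  moreover have "segments = F - (\<lambda>i. (i, 0)) ` {..<s}"
    using F_core by (force simp: segments_def core_def)
  then have "card segments = card F - s"
    using zero_F by (simp add: card_Diff_subset image_subset_iff card_image inj_on_def)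
  moreover have "s \<le> card F"
    using card_mono[OF finite_F, of "(\<lambda>i. (i, 0)) ` {..<s}"] zero_F
    by (simp add: image_subset_iff card_image inj_on_def)
  ultimately show ?thesis using c by linarith
qed

end

section \<open>Hair lengths and the lower bound\<close>

context glued_star
begin

theorem core_length_le:
  assumes top_pos: "\<And>i. i < s \<Longrightarrow> 0 < top i" and a: "a \<in> core"
    and R: "\<And>z. z \<in> core \<Longrightarrow> d a z \<le> R"
    and D: "\<And>y z. y \<in> core \<Longrightarrow> z \<in> core \<Longrightarrow> d y z \<le> D"
  shows "(\<Sum>i<s. top i) \<le> (real k - 1) * D + 2 * R"
proof -
  obtain y where y: "y \<in> core" "\<And>z. z \<in> core \<Longrightarrow> d a z \<le> d a y" using core_farthest[OF a] by blast
  interpret marked_star s k G "glued \<union> {a, y}"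
    by unfold_locales (use finite_glued glued_core a y top_pos in auto)
  let ?F = "glued \<union> {a, y}"
  have aF: "a \<in> ?F" and yF: "y \<in> ?F" by auto
  have aH: "a \<in> H" and yH: "y \<in> H" using aF yF F_H by blast+
  have ay: "d a y = d y a" using d_sym aH yH by blast
  have "sum seg_len segments \<le> (real k - 1) * D + 2 * d a y"
  proof (rule total_length_le[OF distance_from_d[OF aF] distance_from_d[OF yF]])
    show "d a (rep y) = d a y" by (rule lip_rep[OF lip_d[OF aH] yH])
    show "d y (rep a) = d a y" using lip_rep[OF lip_d[OF yH] aH] ay by simp
    show "d a y \<le> d a v + d y v" if "v \<in> rep ` ?F" for v
    proof -
      have "v \<in> H" using that rep_ident F_H ident_subset by blast
      then show ?thesis using d_triangle[OF aH _ yH, of v] d_sym[OF yH] by simp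
    qed
    show "apex (d a) e \<le> d a y" if "e \<in> segments" for e
      using apex_attained[OF aF that] y(2) by force
    show "apex (d y) e \<le> D" if "e \<in> segments" for e
      using apex_attained[OF yF that] D[OF y(1)] by force
    show "d a y \<le> D" using D a y(1) by blast
    show "real (card segments) \<le> real (card (rep ` ?F)) - 1 + real k" by (rule card_segments_le)
  qed
  then show ?thesis using sum_seg_len R[OF y(1)] by simp
qed

text \<open>Nothing beyond \<open>top i\<close> is glued, so a potential can be continued along the
  hair with slope 1 or -1. This yields test functions for distances from the tip.\<close>

definition tilt_hair :: "nat \<Rightarrow> real \<Rightarrow> (nat \<times> real \<Rightarrow> real) \<Rightarrow> nat \<times> real \<Rightarrow> real" where
  "tilt_hair i \<sigma> \<phi> p =
     (if fst p = i \<and> top i < snd p then \<phi> (i, top i) + \<sigma> * (snd p - top i) else \<phi> p)"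

lemma lip_tilt_hair:
  assumes \<phi>: "lip \<phi>" and i: "i < s" and \<sigma>: "\<sigma> = 1 \<or> \<sigma> = -1"
  shows "lip (tilt_hair i \<sigma> \<phi>)"
  unfolding lip_def
proof (intro conjI allI impI ballI, goal_cases)
  case (1 j t u)
  have top: "(i, top i) \<in> H" using top_glued[OF i] glued_subset by blast
  have "\<phi> (j, t) \<le> \<phi> (j, u) + \<bar>t - u\<bar>" using lip_D[OF \<phi>] 1 by blast
  moreover have "\<phi> (i, t) \<le> \<phi> (i, top i) + \<bar>t - top i\<bar>" "\<phi> (i, top i) \<le> \<phi> (i, u) + \<bar>top i - u\<bar>"
    if "j = i" using lip_D[OF \<phi>] 1 top that by blast+
  ultimately show ?case using \<sigma> by (auto simp: tilt_hair_def)
next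
  case (2 x)
  obtain p q where x: "x = (p, q)" by (cases x)
  have "tilt_hair i \<sigma> \<phi> r = \<phi> r" if "r \<in> glued" for r
    using le_top[of "fst r" "snd r"] that by (auto simp: tilt_hair_def)
  moreover have "p \<in> glued \<and> q \<in> glued" if "p \<noteq> q"
    using 2 that by (metis (mono_tags, lifting) glued_def mem_Collect_eq x)
  moreover have "\<phi> p = \<phi> q" using \<phi> 2 by (auto simp: lip_def x)
  ultimately have "tilt_hair i \<sigma> \<phi> p = tilt_hair i \<sigma> \<phi> q" by metis
  then show ?case by (simp add: x)
qed

lemma tip_H: "i < s \<Longrightarrow> (i, 1) \<in> H"
  by (simp add: preglued)

lemma tilt_hair_tip: "i < s \<Longrightarrow> tilt_hair i \<sigma> \<phi> (i, 1) = \<phi> (i, top i) + \<sigma> * (1 - top i)"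
  using top_bounds(2)[of i] by (cases "top i = 1") (auto simp: tilt_hair_def)

text \<open>Test function: 0 on the core, rising along the hair of \<open>i\<close> and falling
  along that of \<open>j\<close>.\<close>

lemma hair_pair_le:
  assumes "i < s" "j < s" "i \<noteq> j"
  shows "(1 - top i) + (1 - top j) \<le> diam G"
proof -
  let ?\<phi> = "tilt_hair j (-1) (\<lambda>_. 0)"
  let ?\<psi> = "tilt_hair i 1 ?\<phi>"
  have "?\<psi> (i, 1) - ?\<psi> (j, 1) \<le> d (j, 1) (i, 1)"
    using assms by (intro d_ge lip_tilt_hair lip_const tip_H) auto
  moreover have "?\<psi> (i, 1) = 1 - top i" using assms by (simp add: tilt_hair_tip) (simp add: tilt_hair_def)
  moreover have "?\<psi> (j, 1) = ?\<phi> (j, 1)" using assms by (simp add: tilt_hair_def[of i])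
  moreover have "?\<phi> (j, 1) = - (1 - top j)" using assms by (simp add: tilt_hair_tip)
  ultimately show ?thesis using d_le_diam[OF tip_H[OF assms(2)] tip_H[OF assms(1)]] by linarith
qed

lemma hair_add_dist_le:
  assumes "i < s" "z \<in> core"
  shows "(1 - top i) + d (i, top i) z \<le> diam G"
proof -
  let ?a = "(i, top i)"
  have aH: "?a \<in> H" using top_glued[OF assms(1)] glued_subset by blast
  have zH: "z \<in> H" using assms core_subset by blast
  let ?\<psi> = "tilt_hair i (-1) (d ?a)"
  have "?\<psi> z - ?\<psi> (i, 1) \<le> d (i, 1) z"
    using assms zH aH by (intro d_ge lip_tilt_hair lip_d tip_H) auto
  moreover have "?\<psi> (i, 1) = - (1 - top i)" using assms aH by (simp add: tilt_hair_tip d_refl)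
  moreover have "?\<psi> z = d ?a z" using assms by (auto simp: tilt_hair_def core_def)
  ultimately show ?thesis using d_le_diam[OF tip_H[OF assms(1)] zH] by linarith
qed

theorem diam_lower_bound:
  assumes k: "s \<le> 2 * k"
  shows "real s \<le> (real k + real s / 2) * diam G"
proof (cases "diam G < 1")
  case False
  then have "(real k + real s / 2) * 1 \<le> (real k + real s / 2) * diam G"
    by (intro mult_left_mono) auto
  then show ?thesis using k by simp
next
  case True
  let ?D = "diam G" and ?h = "\<lambda>i. 1 - top i"
  have a_core: "(i, top i) \<in> core" if "i < s" for i using top_glued[OF that] glued_core by blast
  have aH: "(i, top i) \<in> H" if "i < s" for i using a_core[OF that] core_subset by blast
  have pos: "0 < top i" if i: "i < s" for i
    using hair_add_dist_le[OF i a_core[OF i]] d_refl[OF aH[OF i]] True by simp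
  have "Max (?h ` {..<s}) \<in> ?h ` {..<s}" using two by (intro Max_in) (auto simp: lessThan_empty_iff)
  then obtain j where j: "j < s" "Max (?h ` {..<s}) = ?h j" by blast
  have max: "?h i \<le> ?h j" if "i < s" for i
    using that j(2) Max_ge[of "?h ` {..<s}" "?h i"] by auto
  have core: "(\<Sum>i<s. top i) \<le> (real k - 1) * ?D + 2 * (?D - ?h j)"
  proof (rule core_length_le[OF pos a_core[OF j(1)]])
    show "d (j, top j) z \<le> ?D - ?h j" if "z \<in> core" for z
      using hair_add_dist_le[OF j(1) that] by simp
    show "d y z \<le> ?D" if "y \<in> core" "z \<in> core" for y z
      using d_le_diam that core_subset by blast
  qed
  \<comment> \<open>Any second spike. Its hair is estimated by \<open>?h j\<close> rather than
    \<open>?D / 2\<close>, because the bound for the core saves exactly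
    \<open>2 * ?h j\<close>.\<close>
  define j' where "j' = (if j = 0 then 1 else 0 :: nat)"
  have j': "j' < s" "j' \<noteq> j" using two by (auto simp: j'_def)
  have half: "?h i \<le> ?D / 2" if "i \<in> {..<s} - {j} - {j'}" for i
    using that hair_pair_le[of i j] max[of i] j(1) by auto
  have "(\<Sum>i<s. ?h i) = ?h j + (?h j' + (\<Sum>i\<in>{..<s} - {j} - {j'}. ?h i))"
    using j j' by (simp add: sum.remove)
  also have "\<dots> \<le> ?h j + (?h j + (\<Sum>i\<in>{..<s} - {j} - {j'}. ?D / 2))"
    using max[OF j'(1)] half by (intro add_mono sum_mono) auto
  also have "(\<Sum>i\<in>{..<s} - {j} - {j'}. ?D / 2) = (real s - 2) * (?D / 2)"
    using j(1) j' two by (simp add: card_Diff_singleton of_nat_diff)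
  finally have "real s - (\<Sum>i<s. top i) \<le> 2 * ?h j + (real s - 2) * (?D / 2)"
    by (simp add: sum_subtractf)
  moreover have "(\<Sum>i<s. top i) \<le> (real k - 1) * ?D + (2 * ?D - 2 * ?h j)"
    using core by (simp only: right_diff_distrib)
  ultimately have "real s \<le> (real k - 1) * ?D + 2 * ?D + (real s - 2) * (?D / 2)" by linarith
  also have "\<dots> = (real k + real s / 2) * ?D" by (simp add: field_simps)
  finally show ?thesis .
qed

end

section \<open>Wormholes and fusions\<close>

lemma preglued_star: "preglued (metric_star s) = {..<s} \<times> {0..1}"
  by (auto simp: preglued_def metric_star_def)

lemma preglued_add_wormholes [simp]: "preglued (add_wormholes G ws) = preglued G"
  by (simp add: preglued_def add_wormholes_def)

lemma glue_add_wormholes: "glue (add_wormholes G ws) = glue G \<union> (\<Union>(X, Y)\<in>set ws. X \<times> Y)"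
  by (simp add: add_wormholes_def)

definition collapse_centre :: "nat \<times> real \<Rightarrow> nat \<times> real" where
  "collapse_centre p = (if snd p = 0 then (0, 0) else p)"

lemma collapse_centre_glue: "(p, q) \<in> glue (metric_star s) \<Longrightarrow> collapse_centre p = collapse_centre q"
  by (auto simp: metric_star_def collapse_centre_def)

lemma star_class:
  assumes "p \<in> preglued (metric_star s)"
  shows "ident (metric_star s) `` {p} = (if snd p = 0 then {..<s} \<times> {0} else {p})"
proof (intro equalityI subsetI)
  fix q assume "q \<in> ident (metric_star s) `` {p}"
  then have "(p, q) \<in> ident (metric_star s)" by simp
  then have "collapse_centre p = collapse_centre q" "q \<in> preglued (metric_star s)"
    using ident_invariant[of "metric_star s" collapse_centre p q] collapse_centre_glue ident_subset
    by blast+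
  then show "q \<in> (if snd p = 0 then {..<s} \<times> {0} else {p})"
    by (auto simp: collapse_centre_def preglued_star split: if_splits)
next
  fix q assume q: "q \<in> (if snd p = 0 then {..<s} \<times> {0} else {p})"
  show "q \<in> ident (metric_star s) `` {p}"
  proof (cases "snd p = 0")
    case True
    then have "(p, q) \<in> glue (metric_star s)" "q \<in> preglued (metric_star s)"
      using assms q unfolding preglued_star by (auto simp: metric_star_def)
    then show ?thesis using assms by (auto simp: ident_def)
  next
    case False
    then show ?thesis using assms q by (simp add: ident_refl)
  qed
qed

lemma star_points:
  assumes "X \<in> points (metric_star s)"
  shows "X \<subseteq> preglued (metric_star s)" "finite X" "X \<noteq> {}"
proof -
  obtain p where p: "p \<in> preglued (metric_star s)" "X = ident (metric_star s) `` {p}"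
    using assms by (rule pointsE)
  then have "X = (if snd p = 0 then {..<s} \<times> {0} else {p})" using star_class by simp
  then show "finite X" by simp
  show "X \<subseteq> preglued (metric_star s)" "X \<noteq> {}" using p ident_subset ident_refl by blast+
qed

text \<open>\<open>g\<close> labels positions so that glued ones share a label. The centre costs
  \<open>s - 1\<close> labels, and each wormhole merges two labels, costing at most one
  more.\<close>

lemma add_wormholes_merge:
  assumes "F \<subseteq> preglued (metric_star s)" "finite F" "\<And>i. i < s \<Longrightarrow> (i, 0) \<in> F"
    and "set ws \<subseteq> points (metric_star s) \<times> points (metric_star s)" and "0 < s"
  shows "\<exists>g :: nat \<times> real \<Rightarrow> nat \<times> real. (\<forall>(p, q) \<in> glue (add_wormholes (metric_star s) ws). g p = g q) \<and>
    card F + 1 \<le> card (g ` F) + s + length ws"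
  using assms(4)
proof (induction ws)
  case Nil
  define F' where "F' = {p \<in> F. snd p \<noteq> 0}"
  let ?C = "(\<lambda>i. (i, 0::real)) ` {..<s}"
  have F: "F = ?C \<union> F'" "?C \<inter> F' = {}"
    using assms(1,3) by (auto simp: F'_def preglued_star)
  have "finite F'" using assms(2) by (simp add: F'_def)
  have "card F = card ?C + card F'" using F \<open>finite F'\<close> by (metis card_Un_disjoint finite_imageI finite_lessThan)
  then have "card F = s + card F'" by (simp add: card_image inj_on_def)
  moreover have "insert (0, 0) F' \<subseteq> collapse_centre ` F"
    using assms(3)[of 0] assms(5) by (force simp: F'_def collapse_centre_def image_iff)
  then have "card F' + 1 \<le> card (collapse_centre ` F)"
    using card_mono[of "collapse_centre ` F" "insert (0, 0) F'"] \<open>finite F'\<close> assms(2)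
    by (simp add: F'_def)
  ultimately show ?case
    by (intro exI[of _ collapse_centre]) (auto simp: add_wormholes_def collapse_centre_glue)
next
  case (Cons w ws)
  obtain X Y where w: "w = (X, Y)" "X \<in> points (metric_star s)" "Y \<in> points (metric_star s)"
    using Cons.prems by auto
  obtain g :: "nat \<times> real \<Rightarrow> nat \<times> real"
    where g: "\<And>p q. (p, q) \<in> glue (add_wormholes (metric_star s) ws) \<Longrightarrow> g p = g q"
      and c: "card F + 1 \<le> card (g ` F) + s + length ws"
    using Cons.IH Cons.prems by (auto simp: case_prod_unfold) (metis fst_conv snd_conv)
  \<comment> \<open>A wormhole glues whole classes; since \<open>g\<close> respects the gluing of
    the star, each class carries one label, and a single merger suffices.\<close>
  have const: "g p = g q" if "Z \<in> points (metric_star s)" "p \<in> Z" "q \<in> Z" for Z p q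
  proof -
    obtain z where "Z = ident (metric_star s) `` {z}" using \<open>Z \<in> _\<close> by (rule pointsE)
    then have "(p, q) \<in> ident (metric_star s)" using that(2,3) by (auto intro: ident_sym ident_trans)
    then show ?thesis by (rule ident_invariant[rotated]) (simp add: g glue_add_wormholes)
  qed
  obtain x y where xy: "x \<in> X" "y \<in> Y" using star_points(3) w by blast
  define g' where "g' p = (if g p = g x then g y else g p)" for p
  have "g' p = g' q" if "(p, q) \<in> glue (add_wormholes (metric_star s) (w # ws))" for p q
  proof (cases "(p, q) \<in> X \<times> Y")
    case True
    then have "g p = g x" "g q = g y" using const w xy by blast+
    then show ?thesis by (simp add: g'_def)
  next
    case False
    then have "(p, q) \<in> glue (add_wormholes (metric_star s) ws)"
      using that by (auto simp: glue_add_wormholes w)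
    then show ?thesis using g by (simp add: g'_def)
  qed
  moreover have "card (g ` F) \<le> card (g' ` F) + 1"
  proof -
    have "g ` F \<subseteq> insert (g x) (g' ` F)" by (auto simp: g'_def)
    then have "card (g ` F) \<le> card (insert (g x) (g' ` F))" using assms(2) by (intro card_mono) auto
    also have "\<dots> \<le> card (g' ` F) + 1" using assms(2) by (simp add: card_insert_if)
    finally show ?thesis .
  qed
  ultimately show ?case using c by (intro exI[of _ g']) auto
qed

lemma glued_star_add_wormholes:
  assumes "2 \<le> s" "set ws \<subseteq> points (metric_star s) \<times> points (metric_star s)"
  shows "glued_star s (length ws) (add_wormholes (metric_star s) ws)"
proof
  let ?G = "add_wormholes (metric_star s) ws"
  have "X \<times> Y \<subseteq> preglued (metric_star s) \<times> preglued (metric_star s)" "finite (X \<times> Y)"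
    if "(X, Y) \<in> set ws" for X Y
    using that assms(2) star_points by blast+
  moreover have "glue (metric_star s) = (\<lambda>(i, j). ((i, 0), (j, 0))) ` ({..<s} \<times> {..<s})"
    by (auto simp: metric_star_def image_iff)
  then have "finite (glue (metric_star s))"
    "glue (metric_star s) \<subseteq> preglued (metric_star s) \<times> preglued (metric_star s)"
    by (auto simp: preglued_star)
  ultimately show "glue ?G \<subseteq> preglued ?G \<times> preglued ?G" "finite (glue ?G)"
    unfolding glue_add_wormholes by auto
  show "((i, 0), (j, 0)) \<in> glue ?G" if "i < s" "j < s" for i j
    using that by (auto simp: glue_add_wormholes metric_star_def)
  show "\<exists>g :: nat \<times> real \<Rightarrow> nat \<times> real. (\<forall>(p, q) \<in> glue ?G. g p = g q) \<and>
      card F + 1 \<le> card (g ` F) + s + length ws"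
    if "F \<subseteq> preglued ?G" "finite F" "\<And>i. i < s \<Longrightarrow> (i, 0) \<in> F" for F
    using add_wormholes_merge[OF _ that(2,3) assms(2)] that(1) assms(1) by simp
qed (simp_all add: assms preglued_star)

lemma diam_add_wormholes_ge:
  assumes "2 \<le> s" "1 \<le> n" "length ws = n * s"
    "set ws \<subseteq> points (metric_star s) \<times> points (metric_star s)"
  shows "2 / (2 * real n + 1) \<le> diam (add_wormholes (metric_star s) ws)"
proof -
  let ?D = "diam (add_wormholes (metric_star s) ws)"
  interpret glued_star s "length ws" "add_wormholes (metric_star s) ws"
    by (rule glued_star_add_wormholes[OF assms(1,4)])
  have "s \<le> 2 * length ws" using assms(2,3) by (cases n) auto
  then have "real s \<le> (real (n * s) + real s / 2) * ?D" using diam_lower_bound assms(3) by simp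
  also have "\<dots> = real s * ((2 * real n + 1) / 2 * ?D)" by (simp add: algebra_simps add_divide_distrib)
  finally have "1 \<le> (2 * real n + 1) / 2 * ?D" using assms(1) by simp
  then show ?thesis by (simp add: field_simps)
qed

section \<open>The extremal fusion\<close>

lemma rtrancl_sym_closure_mono:
  assumes "r \<subseteq> (q \<union> q\<inverse>)\<^sup>*"
  shows "(r \<union> r\<inverse>)\<^sup>* \<subseteq> (q \<union> q\<inverse>)\<^sup>*"
proof -
  have "sym ((q \<union> q\<inverse>)\<^sup>*)" by (intro sym_rtrancl sym_Un_converse)
  then have "r \<union> r\<inverse> \<subseteq> (q \<union> q\<inverse>)\<^sup>*" using assms by (auto dest: symD)
  then show ?thesis by (rule rtrancl_subset_rtrancl)
qed

lemma path_of_length_cong: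
  assumes "path_of_length G X Y l" "preglued G = preglued G'" "ident G = ident G'"
  shows "path_of_length G' X Y l"
  using assms(1)
proof induction
  case (stay X)
  then show ?case by (intro path_of_length.stay) (simp add: points_def assms(2,3))
next
  case (move X Y l e t u)
  then show ?case
    using path_of_length.move[of G' X Y l e t u] by (simp add: assms(2,3))
qed

lemma diam_cong:
  assumes "preglued G = preglued G'" "ident G = ident G'"
  shows "diam G = diam G'"
proof -
  have "path_of_length G X Y l \<longleftrightarrow> path_of_length G' X Y l" for X Y l
    using path_of_length_cong assms by metis
  then show ?thesis by (simp add: diam_def graph_dist_def points_def assms)
qed

lemma diam_le_of_net:
  assumes ne: "preglued G \<noteq> {}" and x: "x \<in> preglued G"
    and net: "\<And>e t. (e, t) \<in> preglued G \<Longrightarrow> \<exists>v. \<bar>v - t\<bar> \<le> \<rho> \<and> ((e, v), x) \<in> ident G"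
  shows "diam G \<le> 2 * \<rho>"
proof (rule diam_le[OF ne])
  fix p q assume "p \<in> preglued G" "q \<in> preglued G"
  moreover obtain e t f u where pq: "p = (e, t)" "q = (f, u)" by (cases p, cases q)
  ultimately obtain v w where v: "\<bar>v - t\<bar> \<le> \<rho>" "((e, v), x) \<in> ident G"
    and w: "\<bar>w - u\<bar> \<le> \<rho>" "((f, w), x) \<in> ident G" using net by metis
  then have "((e, v), (f, w)) \<in> ident G" by (metis ident_sym ident_trans)
  then have "path_of_length G (ident G `` {p}) (ident G `` {q}) (\<bar>v - t\<bar> + \<bar>u - w\<bar>)"
    using path_through \<open>p \<in> _\<close> \<open>q \<in> _\<close> by (simp add: pq)
  moreover have "\<bar>v - t\<bar> + \<bar>u - w\<bar> \<le> 2 * \<rho>" using v w by linarith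
  ultimately show "\<exists>l \<le> 2 * \<rho>. path_of_length G (ident G `` {p}) (ident G `` {q}) l" by blast
qed

text \<open>Each product of neighbouring classes links a member of the first to all of the second;
  the exclusion of the empty set provides that member. This is why wormholes between consecutive
  points amount to a fusion.\<close>

lemma consecutive_chain_connected:
  assumes "\<And>x. x \<in> ps ! 0 \<Longrightarrow> (x0, x) \<in> (r \<union> r\<inverse>)\<^sup>*"
    and "(\<Union>(X, Y)\<in>set (zip ps (tl ps)). X \<times> Y) \<subseteq> r" "{} \<notin> set ps"
  shows "i < length ps \<Longrightarrow> x \<in> ps ! i \<Longrightarrow> (x0, x) \<in> (r \<union> r\<inverse>)\<^sup>*"
proof (induction i arbitrary: x)
  case (Suc i)
  have "ps ! i \<in> set ps" using Suc.prems by simp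
  then obtain y where y: "y \<in> ps ! i" using assms(3) by (metis ex_in_conv)
  have "(ps ! i, ps ! Suc i) \<in> set (zip ps (tl ps))"
    using Suc.prems by (auto simp: in_set_zip nth_tl intro!: exI[of _ i])
  then have "(y, x) \<in> r" using y Suc.prems assms(2) by blast
  moreover have "(x0, y) \<in> (r \<union> r\<inverse>)\<^sup>*" using Suc y by simp
  ultimately show ?case by (meson UnI1 rtrancl.rtrancl_into_rtrancl)
qed (use assms(1) in simp)

theorem mainTheorem10:
  fixes s n :: nat
  assumes "s \<ge> 2" and "n \<ge> 1"
  shows "(\<forall>ws. length ws = n * s \<and> set ws \<subseteq> points (metric_star s) \<times> points (metric_star s) \<longrightarrow>
            diam (add_wormholes (metric_star s) ws) \<ge> 2 / (2 * real n + 1)) \<and>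
         (\<exists>ws ps. length ws = n * s \<and>
            set ws \<subseteq> points (metric_star s) \<times> points (metric_star s) \<and>
            diam (add_wormholes (metric_star s) ws) = 2 / (2 * real n + 1) \<and>
            distinct ps \<and> length ps = n * s + 1 \<and> set ps \<subseteq> points (metric_star s) \<and>
            ws = zip ps (tl ps) \<and>
            diam (fusion (metric_star s) (set ps)) = 2 / (2 * real n + 1))"
proof (intro conjI allI impI)
  show "2 / (2 * real n + 1) \<le> diam (add_wormholes (metric_star s) ws)"
    if "length ws = n * s \<and> set ws \<subseteq> points (metric_star s) \<times> points (metric_star s)" for ws
    using diam_add_wormholes_ge assms that by blast
next
  let ?S = "metric_star s"
  \<comment> \<open>The spacing of the marks: the last one on a spike, at
    \<open>n * \<delta> = 1 - \<delta> / 2\<close>, is \<open>\<delta> / 2\<close> away from the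
    tip.\<close>
  define \<delta> where "\<delta> = 2 / (2 * real n + 1)"
  have "0 < \<delta>" by (simp add: \<delta>_def add_pos_nonneg)
  \<comment> \<open>The index \<open>j\<close> starts at 1 because all \<open>(i, 0)\<close>
    represent the centre, listed once as \<open>(0, 0)\<close>.\<close>
  define marks where "marks = (0, 0) # map (\<lambda>(i, j). (i, real j * \<delta>)) (List.product [0..<s] [1..<Suc n])"
  define ps where "ps = map (\<lambda>p. ident ?S `` {p}) marks"
  define ws where "ws = zip ps (tl ps)"
  have marks_set: "set marks = insert (0, 0) {(i, real j * \<delta>) | i j. i < s \<and> 1 \<le> j \<and> j \<le> n}"
  proof -
    have "set (List.product [0..<s] [1..<Suc n]) = {(i, j). i < s \<and> 1 \<le> j \<and> j \<le> n}" by auto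
    then show ?thesis unfolding marks_def list.simps set_map by (auto simp: image_def)
  qed
  have n\<delta>: "real j * \<delta> \<le> 1" if "j \<le> n" for j
    using that by (simp add: \<delta>_def field_simps)
  have marks_sub: "set marks \<subseteq> preglued ?S"
    using n\<delta> \<open>0 < \<delta>\<close> assms(1) by (auto simp: marks_set preglued_star)
  have "inj_on (\<lambda>(i, j). (i, real j * \<delta>)) (set (List.product [0..<s] [1..<Suc n]))"
    using \<open>0 < \<delta>\<close> by (auto simp: inj_on_def)
  then have "distinct marks"
    using \<open>0 < \<delta>\<close> by (auto simp: marks_def distinct_map distinct_product)
  moreover have "inj_on (\<lambda>p. ident ?S `` {p}) (set marks)"
  proof (rule inj_onI)
    fix p q assume pq: "p \<in> set marks" "q \<in> set marks" and eq: "ident ?S `` {p} = ident ?S `` {q}"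
    have "q \<in> ident ?S `` {p}" using eq pq marks_sub ident_refl by blast
    then have q: "q \<in> (if snd p = 0 then {..<s} \<times> {0} else {p})"
      using star_class[of p s] pq(1) marks_sub by blast
    have zero: "r = (0, 0)" if "r \<in> set marks" "snd r = 0" for r
      using that \<open>0 < \<delta>\<close> by (auto simp: marks_set)
    show "p = q"
    proof (cases "snd p = 0")
      case True
      then have "snd q = 0" using q by auto
      then show ?thesis using zero pq True by metis
    qed (use q in simp)
  qed
  ultimately have dist: "distinct ps" by (simp add: ps_def distinct_map)
  have len: "length ps = n * s + 1" by (simp add: ps_def marks_def)
  have ps_sub: "set ps \<subseteq> points ?S" using marks_sub class_in_points unfolding ps_def by fastforce
  have ws_len: "length ws = n * s" by (simp add: ws_def len)
  have "set (tl ps) \<subseteq> set ps" by (cases ps) auto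
  then have ws_ps: "set ws \<subseteq> set ps \<times> set ps"
    by (auto simp: ws_def dest: set_zip_leftD set_zip_rightD)
  then have ws_sub: "set ws \<subseteq> points ?S \<times> points ?S" using ps_sub by blast
  let ?G = "add_wormholes ?S ws" and ?F = "fusion ?S (set ps)"
  let ?r = "glue ?G"
  have conn: "((0, 0), x) \<in> (?r \<union> ?r\<inverse>)\<^sup>*" if "x \<in> \<Union> (set ps)" for x
  proof -
    obtain i where "i < length ps" "x \<in> ps ! i" using \<open>x \<in> \<Union> (set ps)\<close> by (metis UnionE in_set_conv_nth)
    then show ?thesis
    proof (rule consecutive_chain_connected[rotated 3])
      show "{} \<notin> set ps" using ps_sub star_points(3) by blast
      show "(\<Union>(X, Y)\<in>set (zip ps (tl ps)). X \<times> Y) \<subseteq> ?r" by (simp add: glue_add_wormholes ws_def)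
      fix x assume "x \<in> ps ! 0"
      then have "((0, 0), x) \<in> ident ?S" by (simp add: ps_def marks_def)
      then have "((0, 0), x) \<in> (glue ?S \<union> (glue ?S)\<inverse>)\<^sup>*" by (simp add: ident_def)
      then show "((0, 0), x) \<in> (?r \<union> ?r\<inverse>)\<^sup>*"
        by (rule rev_subsetD) (auto simp: glue_add_wormholes intro!: rtrancl_mono)
    qed
  qed
  have symr: "sym ((?r \<union> ?r\<inverse>)\<^sup>*)" by (intro sym_rtrancl sym_Un_converse)
  have pre: "preglued ?F = preglued ?S" by (simp add: preglued_def fusion_def)
  \<comment> \<open>The chain of wormholes and the fusion generate the same equivalence
    relation.\<close>
  have "(?r \<union> ?r\<inverse>)\<^sup>* = (glue ?F \<union> (glue ?F)\<inverse>)\<^sup>*"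
  proof
    have "X \<times> Y \<subseteq> \<Union> (set ps) \<times> \<Union> (set ps)" if "(X, Y) \<in> set ws" for X Y
      using that ws_ps by blast
    then have "(\<Union>(X, Y)\<in>set ws. X \<times> Y) \<subseteq> \<Union> (set ps) \<times> \<Union> (set ps)"
      by (intro UN_least) (simp add: case_prod_beta)
    then have "?r \<subseteq> glue ?F" unfolding glue_add_wormholes by (simp add: fusion_def le_supI2 subset_trans)
    then show "(?r \<union> ?r\<inverse>)\<^sup>* \<subseteq> (glue ?F \<union> (glue ?F)\<inverse>)\<^sup>*" by (intro rtrancl_mono) auto
    have "(x, y) \<in> (?r \<union> ?r\<inverse>)\<^sup>*" if "x \<in> \<Union> (set ps)" "y \<in> \<Union> (set ps)" for x y
      using conn[OF that(1)] conn[OF that(2)] symr by (meson rtrancl_trans symD)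
    then have "\<Union> (set ps) \<times> \<Union> (set ps) \<subseteq> (?r \<union> ?r\<inverse>)\<^sup>*" by blast
    moreover have "glue ?S \<subseteq> (?r \<union> ?r\<inverse>)\<^sup>*" by (auto simp: glue_add_wormholes)
    ultimately have "glue ?F \<subseteq> (?r \<union> ?r\<inverse>)\<^sup>*" by (simp add: fusion_def)
    then show "(glue ?F \<union> (glue ?F)\<inverse>)\<^sup>* \<subseteq> (?r \<union> ?r\<inverse>)\<^sup>*" by (rule rtrancl_sym_closure_mono)
  qed
  then have "ident ?G = ident ?F" by (simp add: ident_def pre)
  then have eq: "diam ?G = diam ?F" by (intro diam_cong) (simp_all add: pre)
  have "diam ?G \<le> 2 * (\<delta> / 2)"
  proof (rule diam_le_of_net)
    show o: "(0, 0) \<in> preglued ?G" using assms(1) by (simp add: preglued_star)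
    then show "preglued ?G \<noteq> {}" by blast
    fix i t assume "(i, t) \<in> preglued ?G"
    then have it: "i < s" "0 \<le> t" "t \<le> 1" by (auto simp: preglued_star)
    \<comment> \<open>Index of a nearest mark. Halves are rounded down, so the tip, where
      \<open>t / \<delta> = n + 1 / 2\<close>, goes to \<open>n\<close> and not to the absent
      \<open>n + 1\<close>. The argument of the ceiling exceeds -1, so \<open>nat\<close> changes
      nothing.\<close>
    define j where "j = nat \<lceil>t / \<delta> - 1 / 2\<rceil>"
    have "0 \<le> t / \<delta>" using it \<open>0 < \<delta>\<close> by simp
    then have "-1 < t / \<delta> - 1 / 2" by linarith
    then have j: "real j = of_int \<lceil>t / \<delta> - 1 / 2\<rceil>" by (simp add: j_def)
    have "t / \<delta> \<le> 1 / \<delta>" using it \<open>0 < \<delta>\<close> by (simp add: divide_right_mono)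
    also have "1 / \<delta> = real n + 1 / 2" by (simp add: \<delta>_def field_simps)
    finally have "j \<le> n" using j by linarith
    have "\<bar>real j - t / \<delta>\<bar> \<le> 1 / 2" using j by linarith
    then have "\<bar>real j - t / \<delta>\<bar> * \<delta> \<le> 1 / 2 * \<delta>" using \<open>0 < \<delta>\<close> by (intro mult_right_mono) auto
    moreover have "\<bar>real j - t / \<delta>\<bar> * \<delta> = \<bar>(real j - t / \<delta>) * \<delta>\<bar>"
      using \<open>0 < \<delta>\<close> by (simp add: abs_mult)
    moreover have "(real j - t / \<delta>) * \<delta> = real j * \<delta> - t"
      using \<open>0 < \<delta>\<close> by (simp add: field_simps)
    ultimately have near: "\<bar>real j * \<delta> - t\<bar> \<le> \<delta> / 2" by simp
    have in_pre: "(i, real j * \<delta>) \<in> preglued ?S"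
      using it n\<delta>[OF \<open>j \<le> n\<close>] \<open>0 < \<delta>\<close> by (simp add: preglued_star)
    have "(i, real j * \<delta>) \<in> \<Union> (set ps)"
    proof (cases "j = 0")
      case True
      have "(i, 0) \<in> ident ?S `` {(0, 0)}"
        using star_class[of "(0, 0)" s] o it by simp
      then show ?thesis using True by (auto simp: ps_def marks_def)
    next
      case False
      then have "(i, real j * \<delta>) \<in> set marks" using it \<open>j \<le> n\<close> by (auto simp: marks_set)
      then show ?thesis using in_pre ident_refl by (fastforce simp: ps_def)
    qed
    then have "((0, 0), (i, real j * \<delta>)) \<in> ident ?G"
      using conn o in_pre by (simp add: ident_def)
    then show "\<exists>v. \<bar>v - t\<bar> \<le> \<delta> / 2 \<and> ((i, v), (0, 0)) \<in> ident ?G"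
      using near ident_sym by blast
  qed
  then have "diam ?G \<le> \<delta>" by simp
  then have "diam ?G = \<delta>"
    using diam_add_wormholes_ge[OF assms ws_len ws_sub] by (simp add: \<delta>_def)
  then show "\<exists>ws ps. length ws = n * s \<and>
            set ws \<subseteq> points (metric_star s) \<times> points (metric_star s) \<and>
            diam (add_wormholes (metric_star s) ws) = 2 / (2 * real n + 1) \<and>
            distinct ps \<and> length ps = n * s + 1 \<and> set ps \<subseteq> points (metric_star s) \<and>
            ws = zip ps (tl ps) \<and>
            diam (fusion (metric_star s) (set ps)) = 2 / (2 * real n + 1)"
    using ws_len ws_sub dist len ps_sub eq ws_def by (intro exI[of _ ws] exI[of _ ps]) (simp add: \<delta>_def)
qed

end
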